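(* Let $X$ be an infinite-dimensional complex Banach space and let $T\in L(X)$ be a $g_z$-Kato operator. Then $\alpha(T_M)$, $\beta(T_M)$, $p(T_M)$ and $q(T_M)$ are independent of the choice of the generalized Kato zeroloid decomposition $(M,N)\in g_zKD(T)$.
   Context: $L(X)$ is the algebra of bounded linear operators on $X$. The operator notions below are also applied to restrictions of operators to closed invariant subspaces (possibly $\{0\}$). For an operator $T$: $\mathcal{N}(T)$, $\mathcal{R}(T)$ are its kernel and range and $\sigma(T)$ its spectrum; $\alpha(T)=\dim\mathcal{N}(T)$ and $\beta(T)=\mathrm{codim}\,\mathcal{R}(T)$; the ascent is $p(T)=\inf\{n\in\mathbb{N}:\mathcal{N}(T^n)=\mathcal{N}(T^{n+1})\}$ and the descent is $q(T)=\inf\{n\in\mathbb{N}:\mathcal{R}(T^n)=\mathcal{R}(T^{n+1})\}$, with $\inf\emptyset=\infty$. $T_M$ is the restriction of $T$ to a $T$-invariant subspace $M$, and $T_{[n]}=T_{\mathcal{R}(T^n)}$ for $n\in\mathbb{N}$. $(M,N)\in\mathrm{Red}(T)$ means that $M,N$ are closed $T$-invariant subspaces with $X=M\oplus N$. $\mathrm{acc}\,A$ is the set of accumulation points of $A\subset\mathbb{C}$. The degree of stable iteration of $T$ is $\mathrm{dis}(T)=\inf\{m\in\mathbb{N}:\alpha(T_{[m]})=\alpha(T_{[r]})\ \text{for all } r\in\mathbb{N},\ r\ge m\}$. $T$ is semi-regular if $\mathcal{R}(T)$ is closed and $\mathrm{dis}(T)=0$. $T$ is zeroloid if $\mathrm{acc}\,\sigma(T)\subset\{0\}$.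 $(M,N)\in g_zKD(T)$ (a generalized Kato zeroloid decomposition) means $(M,N)\in\mathrm{Red}(T)$, $T_M$ is semi-regular and $T_N$ is zeroloid; $T$ is $g_z$-Kato if such a pair exists.
   Formalization: dis(T) is taken as the index from which the kernels N(T_[m]) themselves (not only their dimensions) are constant, so semi-regular means R(T) closed and N(T) ⊂ R(T^m) for all m; with dimensions only, the claim fails when α is infinite. *)

theory Defs
  imports "HOL-Analysis.Analysis" "HOL-Library.Extended_Nat"
begin

class complex_normed_vector = real_normed_vector +
  fixes scaleC :: "complex \<Rightarrow> 'a \<Rightarrow> 'a" (infixr "*\<^sub>C" 75)
  assumes scaleC_add_right: "c *\<^sub>C (x + y) = c *\<^sub>C x + c *\<^sub>C y"
    and scaleC_add_left: "(c + d) *\<^sub>C x = c *\<^sub>C x + d *\<^sub>C x"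
    and scaleC_scaleC: "c *\<^sub>C d *\<^sub>C x = (c * d) *\<^sub>C x"
    and scaleC_of_real: "complex_of_real r *\<^sub>C x = r *\<^sub>R x"
    and norm_scaleC: "norm (c *\<^sub>C x) = cmod c * norm x"

class complex_banach = complex_normed_vector + banach

lemma scaleC_one: "1 *\<^sub>C x = (x :: 'a::complex_normed_vector)"
  using scaleC_of_real[of 1 x] by simp

interpretation cvec: vector_space
  "scaleC :: complex \<Rightarrow> 'a \<Rightarrow> 'a::complex_normed_vector"
  by unfold_locales
    (simp_all add: scaleC_add_right scaleC_add_left scaleC_scaleC scaleC_one)

text \<open>The library's \<^term>\<open>cvec.dim\<close> is a natural number, \<open>0\<close> on
  infinite-dimensional spaces; here such spaces have dimension \<^term>\<open>\<infinity>\<close>.\<close>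

definition cdim :: "'a::complex_normed_vector set \<Rightarrow> enat" where
  "cdim S = (if \<exists>B. finite B \<and> S \<subseteq> cvec.span B then enat (cvec.dim S) else \<infinity>)"

definition ccomplement :: "'a::complex_normed_vector set \<Rightarrow> 'a set \<Rightarrow> 'a set \<Rightarrow> bool" where
  "ccomplement M R C \<longleftrightarrow> cvec.subspace C \<and> R \<inter> C = {0} \<and> {r + c |r c. r \<in> R \<and> c \<in> C} = M"

text \<open>The codimension of \<open>R\<close> in \<open>M\<close>, for subspaces \<open>R \<subseteq> M\<close>. All algebraic complements of
  \<open>R\<close> in \<open>M\<close> are isomorphic to \<open>M / R\<close>, so the infimum ranges over a single value.\<close>

definition ccodim :: "'a::complex_normed_vector set \<Rightarrow> 'a set \<Rightarrow> enat" where
  "ccodim M R = (INF C \<in> {C. ccomplement M R C}. cdim C)"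

text \<open>A notion carrying the arguments \<open>M T\<close> is that notion for the restriction \<open>T\<^sub>M\<close> of \<open>T\<close> to
  the \<open>T\<close>-invariant subspace \<open>M\<close>; the values of \<open>T\<close> outside \<open>M\<close> are irrelevant.
  \<open>bounded_ops M\<close> is \<open>L(M)\<close>.\<close>

definition bounded_ops :: "'a::complex_normed_vector set \<Rightarrow> ('a \<Rightarrow> 'a) set" where
  "bounded_ops M = {T. T ` M \<subseteq> M
     \<and> (\<forall>x\<in>M. \<forall>y\<in>M. T (x + y) = T x + T y)
     \<and> (\<forall>c. \<forall>x\<in>M. T (c *\<^sub>C x) = c *\<^sub>C T x)
     \<and> (\<exists>K. \<forall>x\<in>M. norm (T x) \<le> norm x * K)}"

lemma bounded_ops_UNIV:
  "T \<in> bounded_ops UNIV \<longleftrightarrow> bounded_linear T \<and> (\<forall>c x. T (c *\<^sub>C x) = c *\<^sub>C T x)"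
proof -
  have "T (r *\<^sub>R x) = r *\<^sub>R T x" if "\<And>c x. T (c *\<^sub>C x) = c *\<^sub>C T x" for r x
    using that[of "complex_of_real r" x] by (simp add: scaleC_of_real)
  then show ?thesis
    unfolding bounded_ops_def bounded_linear_def bounded_linear_axioms_def
      linear_iff by auto
qed

definition kernel_on :: "'a set \<Rightarrow> ('a \<Rightarrow> 'a) \<Rightarrow> 'a::complex_normed_vector set" where
  "kernel_on M T = {x \<in> M. T x = 0}"

definition nullity :: "'a::complex_normed_vector set \<Rightarrow> ('a \<Rightarrow> 'a) \<Rightarrow> enat" where
  "nullity M T = cdim (kernel_on M T)"

definition defect :: "'a::complex_normed_vector set \<Rightarrow> ('a \<Rightarrow> 'a) \<Rightarrow> enat" where
  "defect M T = ccodim M (T ` M)"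

text \<open>In \<^typ>\<open>enat\<close> the infimum of the empty set is \<^term>\<open>\<infinity>\<close>.\<close>

definition ascent :: "'a::complex_normed_vector set \<Rightarrow> ('a \<Rightarrow> 'a) \<Rightarrow> enat" where
  "ascent M T = Inf {enat n |n. kernel_on M (T ^^ n) = kernel_on M (T ^^ Suc n)}"

definition descent :: "'a::complex_normed_vector set \<Rightarrow> ('a \<Rightarrow> 'a) \<Rightarrow> enat" where
  "descent M T = Inf {enat n |n. (T ^^ n) ` M = (T ^^ Suc n) ` M}"

definition spectrum_on :: "'a::complex_normed_vector set \<Rightarrow> ('a \<Rightarrow> 'a) \<Rightarrow> complex set" where
  "spectrum_on M T = {z. \<not> (\<exists>S \<in> bounded_ops M. \<forall>x\<in>M.
     S (T x - z *\<^sub>C x) = x \<and> T (S x) - z *\<^sub>C S x = x)}"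

text \<open>The degree of stable iteration is the index from which the decreasing sequence
  \<open>N(T\<^sub>[\<^sub>m\<^sub>]) = N(T) \<inter> R(T\<^sup>m)\<close> is constant. It is often written as stabilisation of the numbers
  \<open>\<alpha>(T\<^sub>[\<^sub>m\<^sub>]) = dim N(T\<^sub>[\<^sub>m\<^sub>])\<close>. When these are finite this is the same condition
  (\<open>nullity_eq_iff_kernel_on_eq\<close> below), but when they are infinite equality of dimensions does
  not give equality of the kernels, and the equality of the kernels is what is meant:
  semi-regular (Kato) operators are those with closed range and \<open>N(T) \<subseteq> R(T\<^sup>m)\<close> for all \<open>m\<close>.
  If \<open>L\<close> is the left shift on \<open>\<ell>\<^sup>2(\<nat>, \<ell>\<^sup>2)\<close>, then \<open>T = L \<oplus> 0\<close> on \<open>\<ell>\<^sup>2(\<nat>, \<ell>\<^sup>2) \<oplus> \<complex>\<close> has closed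
  range and all \<open>\<alpha>(T\<^sub>[\<^sub>m\<^sub>])\<close> infinite, and it is not semi-regular.\<close>

definition dis :: "'a::complex_normed_vector set \<Rightarrow> ('a \<Rightarrow> 'a) \<Rightarrow> enat" where
  "dis M T = Inf {enat m |m. \<forall>r\<ge>m. kernel_on ((T ^^ m) ` M) T = kernel_on ((T ^^ r) ` M) T}"

lemma cdim_eq_imp_eq:
  assumes S: "cvec.subspace S" and SK: "S \<subseteq> K"
    and fin: "cdim K \<noteq> \<infinity>" and eq: "cdim S = cdim K"
  shows "S = K"
proof -
  obtain B where B: "finite B" "K \<subseteq> cvec.span B"
    using fin by (auto simp: cdim_def split: if_splits)
  with SK have "cdim S = enat (cvec.dim S)" "cdim K = enat (cvec.dim K)"
    unfolding cdim_def by (meson subset_trans)+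
  with eq have dim_eq: "cvec.dim S = cvec.dim K" by simp
  obtain A where A: "A \<subseteq> S" "cvec.independent A" "S \<subseteq> cvec.span A" "card A = cvec.dim S"
    using cvec.basis_exists by blast
  obtain A' where A': "A \<subseteq> A'" "A' \<subseteq> K" "cvec.independent A'" "K \<subseteq> cvec.span A'"
    using cvec.maximal_independent_subset_extend[OF subset_trans[OF A(1) SK] A(2)] by blast
  have "finite A'"
    using cvec.independent_span_bound[OF B(1) A'(3)] A'(2) B(2) by blast
  moreover have "card A' = card A"
    using cvec.basis_card_eq_dim[OF A'(2,4,3)] A(4) dim_eq by simp
  ultimately have "A' = A"
    using A'(1) by (metis card_subset_eq)
  then show ?thesis
    using A'(4) A(1) SK cvec.span_minimal[OF A(1) S] by auto
qed

lemma bounded_ops_image_subspace: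
  assumes T: "T \<in> bounded_ops M" and M: "cvec.subspace M"
  shows "cvec.subspace ((T ^^ n) ` M) \<and> (T ^^ n) ` M \<subseteq> M"
proof (induction n)
  case 0
  then show ?case using M by simp
next
  case (Suc n)
  let ?V = "(T ^^ n) ` M"
  from Suc have V: "cvec.subspace ?V" and VM: "?V \<subseteq> M" by auto
  have add: "T (x + y) = T x + T y" and scale: "T (c *\<^sub>C x) = c *\<^sub>C T x"
    if "x \<in> ?V" "y \<in> ?V" for x y c
  proof -
    have "x \<in> M" "y \<in> M" using VM that by blast+
    then show "T (x + y) = T x + T y" "T (c *\<^sub>C x) = c *\<^sub>C T x"
      using T unfolding bounded_ops_def by blast+
  qed
  have "cvec.subspace (T ` ?V)"
  proof (rule cvec.subspaceI)
    have "T 0 = 0"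
      using scale[of 0 0 0] cvec.subspace_0[OF V] by simp
    then show "0 \<in> T ` ?V"
      using imageI[OF cvec.subspace_0[OF V], of T] by simp
  next
    fix u v assume "u \<in> T ` ?V" "v \<in> T ` ?V"
    then obtain x y where x: "x \<in> ?V" "u = T x" and y: "y \<in> ?V" "v = T y" by blast
    show "u + v \<in> T ` ?V"
      using imageI[OF cvec.subspace_add[OF V x(1) y(1)], of T] add[OF x(1) y(1)] x(2) y(2) by simp
  next
    fix c u assume "u \<in> T ` ?V"
    then obtain x where x: "x \<in> ?V" "u = T x" by blast
    show "c *\<^sub>C u \<in> T ` ?V"
      using imageI[OF cvec.subspace_scale[OF V x(1)], of T c] scale[OF x(1) x(1)] x(2) by simp
  qed
  moreover have "T ` ?V \<subseteq> M"
    using VM T by (auto simp: bounded_ops_def)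
  moreover have "(T ^^ Suc n) ` M = T ` ?V"
    by (simp add: image_comp)
  ultimately show ?case by simp
qed

lemma nullity_eq_iff_kernel_on_eq:
  assumes T: "T \<in> bounded_ops M" and M: "cvec.subspace M" and mr: "m \<le> r"
    and fin: "nullity ((T ^^ m) ` M) T \<noteq> \<infinity>"
  shows "nullity ((T ^^ m) ` M) T = nullity ((T ^^ r) ` M) T
    \<longleftrightarrow> kernel_on ((T ^^ m) ` M) T = kernel_on ((T ^^ r) ` M) T"
proof
  let ?K = "\<lambda>n. kernel_on ((T ^^ n) ` M) T"
  assume eq: "nullity ((T ^^ m) ` M) T = nullity ((T ^^ r) ` M) T"
  have V: "cvec.subspace ((T ^^ r) ` M)" and VM: "(T ^^ r) ` M \<subseteq> M"
    using bounded_ops_image_subspace[OF T M] by auto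
  have add: "T (x + y) = T x + T y" and scale: "T (c *\<^sub>C x) = c *\<^sub>C T x"
    if "x \<in> M" "y \<in> M" for x y c
    using T that by (auto simp: bounded_ops_def)
  have "T 0 = 0"
    using scale[of 0 0 0] cvec.subspace_0[OF M] by simp
  then have "cvec.subspace (?K r)"
    using VM V add scale
    by (auto simp: kernel_on_def subset_iff cvec.subspace_def)
  moreover have "?K r \<subseteq> ?K m"
  proof -
    have "(T ^^ r) ` M = (T ^^ m) ` (T ^^ (r - m)) ` M"
      using mr by (metis funpow_add image_comp le_add_diff_inverse)
    then have "(T ^^ r) ` M \<subseteq> (T ^^ m) ` M"
      using bounded_ops_image_subspace[OF T M, of "r - m"] by (simp add: image_mono)
    then show ?thesis by (auto simp: kernel_on_def)
  qed
  ultimately show "?K m = ?K r"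
    using cdim_eq_imp_eq[of "?K r" "?K m"] fin eq unfolding nullity_def by metis
qed (simp add: nullity_def)

definition semi_regular :: "'a::complex_normed_vector set \<Rightarrow> ('a \<Rightarrow> 'a) \<Rightarrow> bool" where
  "semi_regular M T \<longleftrightarrow> closed (T ` M) \<and> dis M T = 0"

definition zeroloid :: "'a::complex_normed_vector set \<Rightarrow> ('a \<Rightarrow> 'a) \<Rightarrow> bool" where
  "zeroloid M T \<longleftrightarrow> {z. z islimpt spectrum_on M T} \<subseteq> {0}"

definition Red :: "('a \<Rightarrow> 'a) \<Rightarrow> ('a::complex_normed_vector set \<times> 'a set) set" where
  "Red T = {(M, N). cvec.subspace M \<and> closed M \<and> T ` M \<subseteq> M
     \<and> cvec.subspace N \<and> closed N \<and> T ` N \<subseteq> N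
     \<and> M \<inter> N = {0} \<and> {x + y |x y. x \<in> M \<and> y \<in> N} = UNIV}"

definition gzKD :: "('a \<Rightarrow> 'a) \<Rightarrow> ('a::complex_normed_vector set \<times> 'a set) set" where
  "gzKD T = {(M, N) \<in> Red T. semi_regular M T \<and> zeroloid N T}"

definition gz_Kato :: "('a::complex_normed_vector \<Rightarrow> 'a) \<Rightarrow> bool" where
  "gz_Kato T \<longleftrightarrow> gzKD T \<noteq> {}"

end

theory Submission
  imports Defs
begin

text \<open>
  Let \<open>(M, N)\<close> and \<open>(M', N')\<close> be two generalized Kato zeroloid decompositions of \<open>T\<close>. The spectra
  of \<open>T\<^sub>N\<close> and \<open>T\<^sub>N'\<close> accumulate at most at \<open>0\<close>, so there are arbitrarily small \<open>z\<close> outside both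
  (\<open>frequently_resolvent\<close>). For such \<open>z\<close> the summands \<open>N\<close> and \<open>N'\<close> contribute nothing to the kernel
  and to the cokernel of \<open>T - z\<close>, so nullity and defect of \<open>T - z\<close> are the same on \<open>M\<close>, on the whole
  space and on \<open>M'\<close> (\<open>shift_restriction_eq\<close>).

  It remains to let \<open>z\<close> tend to \<open>0\<close>, which is the analytic core: for a semi-regular operator, nullity
  and defect do not change under small shifts (\<open>eventually_nullity_ge_iff\<close>,
  \<open>eventually_defect_ge_iff\<close>). The reason is that the kernel of \<open>T\<close> lies in the range of every power
  of \<open>T\<close>, so each kernel vector continues to a power series in \<open>z\<close> of kernel vectors of \<open>T - z\<close>
  (\<open>eventually_kernel_close\<close>). Conversely, kernel vectors of \<open>T - z\<close> are close to the kernel of \<open>T\<close>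
  because the range is closed. These two facts control the kernels, and, by reducing preimages modulo
  the kernel, also the ranges. The series needed here are all produced by one iteration,
  \<open>successive_approximation\<close>, which also yields the open mapping theorem.

  Ascent and descent then follow: a semi-regular operator has ascent \<open>0\<close> if it is injective and
  \<open>\<infinity>\<close> otherwise, and descent \<open>0\<close> if it is surjective and \<open>\<infinity>\<close> otherwise (\<open>ascent_eq\<close>,
  \<open>descent_eq\<close>), so they are determined by nullity and defect.
\<close>

section \<open>Successive approximation and open mappings\<close>

text \<open>If every \<open>y \<in> Y\<close> has a controlled approximate preimage whose error lies in \<open>Y\<close> again and is
  smaller by a factor \<open>q < 1\<close>, then feeding the error back in gives a geometric series of corrections
  that sums to an exact preimage. The set \<open>Y\<close> is arbitrary so that it can be an
  intersection of ranges of powers of an operator, which is not known to be closed.\<close>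

lemma successive_approximation:
  fixes f :: "'a::banach \<Rightarrow> 'b::real_normed_vector"
  assumes f: "bounded_linear f" and S: "subspace S" "closed S"
    and q: "0 \<le> q" "q < 1" and c: "0 \<le> c"
    and step: "\<And>y. y \<in> Y \<Longrightarrow>
      \<exists>x\<in>S. norm x \<le> c * norm y \<and> y - f x \<in> Y \<and> norm (y - f x) \<le> q * norm y"
    and y: "y \<in> Y"
  shows "\<exists>x\<in>S. f x = y \<and> norm x \<le> c / (1 - q) * norm y"
proof -
  interpret f: bounded_linear f by (rule f)
  have ch: "\<forall>y\<in>Y. \<exists>x. x \<in> S \<and> norm x \<le> c * norm y \<and> y - f x \<in> Y \<and> norm (y - f x) \<le> q * norm y"
    using step by (simp add: Bex_def)
  obtain g where g: "\<forall>y\<in>Y. g y \<in> S \<and> norm (g y) \<le> c * norm y \<and> y - f (g y) \<in> Y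
      \<and> norm (y - f (g y)) \<le> q * norm y"
    by (rule exE[OF bchoice[OF ch]]) (rule that)
  have gS: "g y \<in> S" and gn: "norm (g y) \<le> c * norm y" and gY: "y - f (g y) \<in> Y"
    and gq: "norm (y - f (g y)) \<le> q * norm y" if "y \<in> Y" for y
    using g[rule_format, OF that] by simp_all
  \<comment> \<open>the error that is left after \<open>n\<close> corrections\<close>
  define r where "r n = ((\<lambda>y. y - f (g y)) ^^ n) y" for n
  have r_Suc: "r (Suc n) = r n - f (g (r n))" for n by (simp add: r_def)
  have rY: "r n \<in> Y" for n
    by (induction n) (use y gY in \<open>auto simp: r_def\<close>)
  have rn: "norm (r n) \<le> q ^ n * norm y" for n
  proof (induction n)
    case (Suc n)
    have "norm (r (Suc n)) \<le> q * norm (r n)" using gq[OF rY] by (simp add: r_Suc)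
    also have "\<dots> \<le> q * (q ^ n * norm y)" by (rule mult_left_mono[OF Suc q(1)])
    finally show ?case by simp
  qed (simp add: r_def)
  have term_bound: "norm (g (r n)) \<le> c * norm y * q ^ n" for n
    using gn[OF rY, of n] mult_left_mono[OF rn c, of n] by (simp add: mult_ac)
  have geo: "(\<lambda>n. c * norm y * q ^ n) sums (c * norm y * (1 / (1 - q)))"
    using q by (intro sums_mult geometric_sums) simp
  have summ_norm: "summable (\<lambda>n. norm (g (r n)))"
    by (rule summable_comparison_test[OF _ sums_summable[OF geo]]) (use term_bound in auto)
  have summ: "summable (\<lambda>n. g (r n))" by (rule summable_norm_cancel[OF summ_norm])
  define x where "x = (\<Sum>n. g (r n))"
  have lim: "(\<lambda>n. \<Sum>i<n. g (r i)) \<longlonglongrightarrow> x"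
    using summable_LIMSEQ[OF summ] by (simp add: x_def)
  have "x \<in> S"
    by (rule closed_sequentially[OF S(2) _ lim]) (use gS rY S(1) in \<open>auto intro: subspace_sum\<close>)
  moreover have "f x = y"
  proof -
    have "(\<lambda>n. norm y * q ^ n) \<longlonglongrightarrow> norm y * 0"
      using q by (intro tendsto_mult tendsto_const LIMSEQ_realpow_zero) auto
    then have r0: "r \<longlonglongrightarrow> 0"
      by (intro Lim_null_comparison[of r "\<lambda>n. norm y * q ^ n"])
        (use rn in \<open>auto simp: mult.commute\<close>)
    have "(\<lambda>n. r n - r (Suc n)) sums (r 0 - 0)" by (rule telescope_sums'[OF r0])
    then have "(\<lambda>n. f (g (r n))) sums y" by (simp add: r_Suc) (simp add: r_def)
    moreover have "(\<lambda>n. f (g (r n))) sums f x"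
      unfolding x_def by (rule f.sums[OF summable_sums[OF summ]])
    ultimately show ?thesis using sums_unique2 by blast
  qed
  moreover have "norm x \<le> c / (1 - q) * norm y"
  proof -
    have "norm x \<le> (\<Sum>n. norm (g (r n)))" unfolding x_def by (rule summable_norm[OF summ_norm])
    also have "\<dots> \<le> c * norm y * (1 / (1 - q))"
      using suminf_le[OF term_bound summ_norm sums_summable[OF geo]] sums_unique[OF geo] by simp
    finally show ?thesis by simp
  qed
  ultimately show ?thesis by blast
qed

text \<open>The corrections \<open>s \<in> S\<close> of successive approximation for the identity sum up to \<open>y\<close> itself.\<close>

lemma closed_subspace_halving:
  fixes Y S :: "'a::banach set"
  assumes S: "subspace S" "closed S"
    and step: "\<And>y. y \<in> Y \<Longrightarrow> \<exists>s\<in>S. y - s \<in> Y \<and> norm (y - s) \<le> 1/2 * norm y"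
  shows "Y \<subseteq> S"
proof
  fix y assume "y \<in> Y"
  then have "\<exists>s\<in>S. s = y \<and> norm s \<le> 2 / (1 - 1/2) * norm y"
  proof (rule successive_approximation[OF bounded_linear_ident S(1) S(2), rotated -1])
    fix y assume "y \<in> Y"
    from step[OF this] obtain s where s: "s \<in> S" "y - s \<in> Y" "norm (y - s) \<le> 1/2 * norm y" by blast
    have "norm s \<le> norm y + norm (y - s)" using norm_triangle_sub[of s y] by (simp add: norm_minus_commute)
    then have "norm s \<le> 2 * norm y" using s(3) norm_ge_zero[of y] by linarith
    then show "\<exists>s\<in>S. norm s \<le> 2 * norm y \<and> y - s \<in> Y \<and> norm (y - s) \<le> 1/2 * norm y"
      using s by blast
  qed auto
  then show "y \<in> S" by blast
qed

text \<open>The open mapping theorem for an operator from a closed subspace onto its closed range. By Baire's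
  theorem in the range, the closure of the image of some ball has a relative interior point;
  subtracting two approximants near that point gives approximate preimages with error factor
  \<open>1/2\<close>, and successive approximation makes them exact.\<close>

lemma open_mapping_closed_image:
  fixes f :: "'a::banach \<Rightarrow> 'b::banach"
  assumes f: "bounded_linear f" and S: "subspace S" "closed S" and cl: "closed (f ` S)"
  shows "\<exists>c>0. \<forall>y\<in>f ` S. \<exists>x\<in>S. f x = y \<and> norm x \<le> c * norm y"
proof -
  interpret f: bounded_linear f by (rule f)
  define Y where "Y = f ` S"
  define A where "A n = closure (f ` (S \<inter> cball 0 (real n)))" for n :: nat
  have sub: "subspace Y" unfolding Y_def by (rule linear_subspace_image[OF f.linear S(1)])
  have AY: "A n \<subseteq> Y" for n
    unfolding A_def Y_def by (rule closure_minimal) (use cl in auto)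
  have "\<exists>n. top_of_set Y interior_of A n \<noteq> {}"
  proof (rule ccontr)
    assume "\<not> ?thesis"
    then have empty: "\<And>n. top_of_set Y interior_of A n = {}" by blast
    have "completely_metrizable_space (top_of_set Y)"
      using completely_metrizable_space_closedin[OF completely_metrizable_space_euclidean] cl
      unfolding Y_def by (metis closed_closedin)
    moreover have "closedin (top_of_set Y) (A n)" for n
      using AY by (intro closed_subset) (auto simp: A_def)
    ultimately have "top_of_set Y interior_of (\<Union>(range A)) = {}"
      using empty by (intro Baire_category_alt) auto
    moreover have "(\<Union>(range A)) = Y"
    proof
      show "Y \<subseteq> \<Union>(range A)"
      proof
        fix y assume "y \<in> Y"
        then obtain x where x: "x \<in> S" "y = f x" unfolding Y_def by blast
        obtain n :: nat where "norm x \<le> real n" using real_arch_simple by blast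
        then have "y \<in> A n" unfolding A_def using x closure_subset by fastforce
        then show "y \<in> \<Union>(range A)" by blast
      qed
    qed (use AY in blast)
    ultimately have "Y = {}" using interior_of_topspace[of "top_of_set Y"] by simp
    then show False using subspace_0[OF sub] by simp
  qed
  then obtain n y0 where "y0 \<in> top_of_set Y interior_of A n" by blast
  then obtain U where U: "openin (top_of_set Y) U" "y0 \<in> U" "U \<subseteq> A n"
    unfolding interior_of_def by blast
  then obtain r where r: "r > 0" and rU: "\<And>y. y \<in> Y \<Longrightarrow> dist y y0 < r \<Longrightarrow> y \<in> A n"
    unfolding openin_euclidean_subtopology_iff by blast
  have y0: "y0 \<in> A n" "y0 \<in> Y" using U AY by auto
  have appr: "\<exists>x\<in>S. norm x \<le> real n \<and> norm (y - f x) < e" if "y \<in> A n" "e > 0" for y e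
  proof -
    from that obtain z where "z \<in> f ` (S \<inter> cball 0 (real n))" "dist z y < e"
      unfolding A_def closure_approachable by blast
    then show ?thesis by (auto simp: dist_norm norm_minus_commute)
  qed
  have step: "\<exists>x\<in>S. norm x \<le> (4 * real n / r) * norm y \<and> y - f x \<in> Y
      \<and> norm (y - f x) \<le> 1/2 * norm y" if y: "y \<in> Y" for y
  proof (cases "y = 0")
    case True
    then show ?thesis using subspace_0[OF S(1)] subspace_0[OF sub] by (intro bexI[of _ 0]) auto
  next
    case False
    \<comment> \<open>Scaled to norm \<open>r/2\<close>, the vector is a difference of two points of \<open>A n\<close>. Approximating each
      of them up to \<open>r/8\<close> leaves an error of at most \<open>r/4\<close>, half of the scaled norm.\<close>
    define t where "t = r / (2 * norm y)"
    have t: "t > 0" "t * norm y = r / 2" using False r by (auto simp: t_def)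
    have "y0 + t *\<^sub>R y \<in> Y" using y y0(2) sub by (intro subspace_add subspace_scale)
    moreover have "dist (y0 + t *\<^sub>R y) y0 < r" using t r by (simp add: dist_norm)
    ultimately have "y0 + t *\<^sub>R y \<in> A n" by (rule rU)
    then obtain x1 where x1: "x1 \<in> S" "norm x1 \<le> real n" "norm (y0 + t *\<^sub>R y - f x1) < r/8"
      using appr[of "y0 + t *\<^sub>R y" "r/8"] r by auto
    obtain x2 where x2: "x2 \<in> S" "norm x2 \<le> real n" "norm (y0 - f x2) < r/8"
      using appr[OF y0(1), of "r/8"] r by auto
    define x where "x = (1/t) *\<^sub>R (x1 - x2)"
    have xS: "x \<in> S" unfolding x_def using x1 x2 S(1) by (intro subspace_scale subspace_diff)
    have "norm (x1 - x2) \<le> 2 * real n" using norm_triangle_ineq4[of x1 x2] x1 x2 by linarith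
    then have "norm x \<le> (1/t) * (2 * real n)" using t(1) by (simp add: x_def divide_simps)
    then have nx: "norm x \<le> (4 * real n / r) * norm y" using False r by (simp add: t_def field_simps)
    have eq: "y - f x = (1/t) *\<^sub>R ((y0 + t *\<^sub>R y - f x1) - (y0 - f x2))"
      using t(1) by (simp add: x_def f.scaleR f.diff algebra_simps)
    have "norm ((y0 + t *\<^sub>R y - f x1) - (y0 - f x2)) \<le> r/4"
      using norm_triangle_ineq4[of "y0 + t *\<^sub>R y - f x1" "y0 - f x2"] x1 x2 by linarith
    then have "norm (y - f x) \<le> (1/t) * (r/4)"
      unfolding eq using t(1) by (simp add: divide_simps)
    also have "\<dots> = 1/2 * norm y" using False r by (simp add: t_def field_simps)
    finally have "norm (y - f x) \<le> 1/2 * norm y" .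
    moreover have "y - f x \<in> Y" using y xS sub unfolding Y_def by (intro subspace_diff) auto
    ultimately show ?thesis using nx xS by blast
  qed
  define c where "c = 4 * real n / r / (1 - 1/2) + 1"
  have cpos: "c > 0" using r unfolding c_def by (intro add_nonneg_pos divide_nonneg_nonneg) auto
  have "\<exists>x\<in>S. f x = y \<and> norm x \<le> c * norm y" if y: "y \<in> Y" for y
  proof -
    have "\<exists>x\<in>S. f x = y \<and> norm x \<le> (4 * real n / r) / (1 - 1/2) * norm y"
      by (rule successive_approximation[OF f S _ _ _ step y]) (use r in auto)
    moreover have "(4 * real n / r) / (1 - 1/2) * norm y \<le> c * norm y"
      by (rule mult_right_mono) (auto simp: c_def)
    ultimately show ?thesis by (meson order_trans)
  qed
  then show ?thesis using cpos unfolding Y_def by blast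
qed

section \<open>Dimension and codimension\<close>

lemma csubspace_imp_subspace: "cvec.subspace S \<Longrightarrow> subspace S"
  unfolding subspace_def cvec.subspace_def by (metis scaleC_of_real)

lemma bounded_linear_scaleC: "bounded_linear (\<lambda>x::'a::complex_normed_vector. c *\<^sub>C x)"
  by (rule bounded_linear_intro[where K = "cmod c"])
    (simp_all add: scaleC_add_right norm_scaleC mult.commute cvec.scale_left_commute
      flip: scaleC_of_real)

lemma tendsto_scaleC:
  fixes v :: "'a::complex_normed_vector"
  assumes "(k \<longlongrightarrow> l) F"
  shows "((\<lambda>n. k n *\<^sub>C v) \<longlongrightarrow> l *\<^sub>C v) F"
proof -
  have "bounded_linear (\<lambda>k. k *\<^sub>C v)"
    by (rule bounded_linear_intro[where K = "norm v"])
      (simp_all add: scaleC_add_left norm_scaleC scaleC_of_real[symmetric] scaleC_scaleC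
        scaleR_conv_of_real)
  from bounded_linear.tendsto[OF this assms] show ?thesis .
qed

text \<open>Dimensions and codimensions are compared below through the sizes \<open>k\<close> of finite independent sets,
  so that infinite values need no separate treatment.\<close>

lemma enat_le_cdim_iff:
  "enat k \<le> cdim S \<longleftrightarrow> (\<exists>B\<subseteq>S. finite B \<and> cvec.independent B \<and> card B = k)"
proof
  assume k: "enat k \<le> cdim S"
  obtain A where A: "A \<subseteq> S" "cvec.independent A" "S \<subseteq> cvec.span A" "card A = cvec.dim S"
    using cvec.basis_exists by blast
  have "\<exists>B\<subseteq>A. finite B \<and> card B = k"
  proof (cases "finite A")
    case True
    then have "cdim S = enat (card A)" using A by (auto simp: cdim_def)
    with k have "k \<le> card A" by simp
    then show ?thesis by (metis obtain_subset_with_card_n)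
  next
    case False
    then show ?thesis using infinite_arbitrarily_large by blast
  qed
  then obtain B where "B \<subseteq> A" "finite B" "card B = k" by blast
  then show "\<exists>B\<subseteq>S. finite B \<and> cvec.independent B \<and> card B = k"
    using A(1) cvec.independent_mono[OF A(2)] by (intro exI[of _ B]) auto
next
  assume "\<exists>B\<subseteq>S. finite B \<and> cvec.independent B \<and> card B = k"
  then obtain B where B: "B \<subseteq> S" "finite B" "cvec.independent B" "card B = k" by blast
  show "enat k \<le> cdim S"
  proof (cases "\<exists>D. finite D \<and> S \<subseteq> cvec.span D")
    case True
    then obtain D where D: "finite D" "S \<subseteq> cvec.span D" by blast
    obtain A where A: "B \<subseteq> A" "A \<subseteq> S" "cvec.independent A" "S \<subseteq> cvec.span A"
      using cvec.maximal_independent_subset_extend[OF B(1,3)] by blast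
    have "finite A" using cvec.independent_span_bound[OF D(1) A(3)] A(2) D(2) by blast
    then have "k \<le> card A" using A(1) B(4) card_mono by blast
    then show ?thesis using cvec.basis_card_eq_dim[OF A(2,4,3)] True by (simp add: cdim_def)
  qed (auto simp: cdim_def)
qed

lemma cdim_finite_basis:
  assumes "cdim S \<noteq> \<infinity>"
  obtains A where "A \<subseteq> S" "finite A" "cvec.independent A" "S \<subseteq> cvec.span A" "cdim S = enat (card A)"
proof -
  obtain D where D: "finite D" "S \<subseteq> cvec.span D"
    using assms by (auto simp: cdim_def split: if_splits)
  obtain A where A: "A \<subseteq> S" "cvec.independent A" "S \<subseteq> cvec.span A" "card A = cvec.dim S"
    using cvec.basis_exists by blast
  have "finite A" using cvec.independent_span_bound[OF D(1) A(2)] A(1) D(2) by blast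
  moreover have "cdim S = enat (card A)" using A D by (auto simp: cdim_def)
  ultimately show ?thesis using that A by blast
qed

lemma independent_image_if_no_relation:
  fixes p :: "'b \<Rightarrow> 'a::complex_normed_vector"
  assumes "finite B"
    and nr: "\<And>a. (\<Sum>b\<in>B. a b *\<^sub>C p b) = 0 \<Longrightarrow> \<forall>b\<in>B. a b = 0"
  shows "inj_on p B \<and> cvec.independent (p ` B)"
proof
  show inj: "inj_on p B"
  proof (rule inj_onI, rule ccontr)
    fix b b' assume b: "b \<in> B" "b' \<in> B" "p b = p b'" "b \<noteq> b'"
    define a :: "'b \<Rightarrow> complex" where "a x = (if x = b then 1 else 0) - (if x = b' then 1 else 0)" for x
    have "(\<Sum>x\<in>B. a x *\<^sub>C p x) = (\<Sum>x\<in>B. (if x = b then p x else 0) - (if x = b' then p x else 0))"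
      by (rule sum.cong) (auto simp: a_def cvec.scale_left_diff_distrib)
    also have "\<dots> = 0" using b assms(1) by (simp add: sum_subtractf)
    finally have "a b = 0" using nr b by blast
    then show False using b by (simp add: a_def)
  qed
  show "cvec.independent (p ` B)"
  proof (rule cvec.independent_if_scalars_zero)
    fix g x assume "(\<Sum>x\<in>p ` B. g x *\<^sub>C x) = 0" "x \<in> p ` B"
    then show "g x = 0" using nr[of "\<lambda>b. g (p b)"] by (auto simp: sum.reindex[OF inj])
  qed (use assms in simp)
qed

text \<open>The exchange lemma in the quotient by \<open>R\<close>: subtracting suitable elements of \<open>R\<close> moves \<open>B\<close> into
  \<open>span D\<close> without creating relations, since a relation would put a nonzero vector of \<open>span B\<close>
  into \<open>R\<close>.\<close>

lemma independent_modulo_card_le: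
  assumes R: "cvec.subspace R" and B: "finite B" "cvec.independent B" "cvec.span B \<inter> R \<subseteq> {0}"
    and D: "finite D" and BD: "\<And>b. b \<in> B \<Longrightarrow> \<exists>r\<in>R. b - r \<in> cvec.span D"
  shows "card B \<le> card D"
proof -
  have "\<forall>b\<in>B. \<exists>r. r \<in> R \<and> b - r \<in> cvec.span D" using BD by blast
  from bchoice[OF this] obtain r where r: "\<forall>b\<in>B. r b \<in> R \<and> b - r b \<in> cvec.span D" ..
  have "inj_on (\<lambda>b. b - r b) B \<and> cvec.independent ((\<lambda>b. b - r b) ` B)"
  proof (rule independent_image_if_no_relation[OF B(1)])
    fix a assume "(\<Sum>b\<in>B. a b *\<^sub>C (b - r b)) = 0"
    then have eq: "(\<Sum>b\<in>B. a b *\<^sub>C b) = (\<Sum>b\<in>B. a b *\<^sub>C r b)"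
      by (simp add: cvec.scale_right_diff_distrib sum_subtractf)
    have "(\<Sum>b\<in>B. a b *\<^sub>C r b) \<in> R"
      using R r by (intro cvec.subspace_sum cvec.subspace_scale) auto
    moreover have "(\<Sum>b\<in>B. a b *\<^sub>C b) \<in> cvec.span B"
      by (intro cvec.span_sum cvec.span_scale cvec.span_base)
    ultimately have "(\<Sum>b\<in>B. a b *\<^sub>C b) = 0" using eq B(3) by auto
    then show "\<forall>b\<in>B. a b = 0" using cvec.independentD[OF B(2,1) subset_refl] by blast
  qed
  then have inj: "inj_on (\<lambda>b. b - r b) B" and ind: "cvec.independent ((\<lambda>b. b - r b) ` B)" by auto
  have "card ((\<lambda>b. b - r b) ` B) \<le> card D"
    using cvec.independent_span_bound[OF D ind] r by blast
  then show ?thesis by (simp add: card_image[OF inj])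
qed

lemma independent_span_Int:
  assumes A': "cvec.independent A'" and "A \<subseteq> A'"
  shows "cvec.span A \<inter> cvec.span (A' - A) = {0}"
proof -
  have "x = 0" if x: "x \<in> cvec.span A" "x \<in> cvec.span (A' - A)" for x
  proof -
    have A: "cvec.independent A" "cvec.independent (A' - A)"
      using assms cvec.independent_mono by blast+
    have "cvec.representation A' x = cvec.representation A x"
      using cvec.representation_extend[OF A' x(1) assms(2)] .
    moreover have "cvec.representation A' x = cvec.representation (A' - A) x"
      using cvec.representation_extend[OF A' x(2)] by blast
    ultimately have "cvec.representation A x b = 0" for b
      using cvec.representation_ne_zero by (metis DiffD2)
    then show ?thesis using cvec.sum_nonzero_representation_eq[OF A(1) x(1)] by simp
  qed
  then show ?thesis using cvec.span_zero by blast
qed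

lemma ccomplement_exists:
  assumes "cvec.subspace M" "cvec.subspace R" "R \<subseteq> M"
  shows "\<exists>C. ccomplement M R C"
proof -
  obtain A where A: "A \<subseteq> R" "cvec.independent A" "R \<subseteq> cvec.span A"
    using cvec.maximal_independent_subset[of R] by blast
  obtain A' where A': "A \<subseteq> A'" "A' \<subseteq> M" "cvec.independent A'" "M \<subseteq> cvec.span A'"
    using cvec.maximal_independent_subset_extend[of A M] A assms(3) by blast
  have spA: "cvec.span A = R" using A assms(2) cvec.span_minimal by blast
  have spA': "cvec.span A' = M" using A' assms(1) cvec.span_minimal by blast
  have "R \<inter> cvec.span (A' - A) = {0}"
    using independent_span_Int[OF A'(3,1)] spA by auto
  moreover have "{r + c |r c. r \<in> R \<and> c \<in> cvec.span (A' - A)} = M"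
    using cvec.span_Un[of A "A' - A"] spA spA' A'(1) by (simp add: Un_absorb1)
  ultimately show ?thesis unfolding ccomplement_def by auto
qed

lemma enat_le_cdim_ccomplement_iff:
  assumes R: "cvec.subspace R" and C: "ccomplement M R C"
  shows "enat k \<le> cdim C \<longleftrightarrow> (\<exists>B\<subseteq>M. finite B \<and> cvec.independent B \<and> card B = k
    \<and> cvec.span B \<inter> R \<subseteq> {0})"
proof
  have sC: "cvec.subspace C" and RC: "R \<inter> C = {0}" and sum: "{r + c |r c. r \<in> R \<and> c \<in> C} = M"
    using C by (auto simp: ccomplement_def)
  have CM: "C \<subseteq> M" using sum cvec.subspace_0[OF R] by force
  show "\<exists>B\<subseteq>M. finite B \<and> cvec.independent B \<and> card B = k \<and> cvec.span B \<inter> R \<subseteq> {0}"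
    if k: "enat k \<le> cdim C"
  proof -
    obtain B where B: "B \<subseteq> C" "finite B" "cvec.independent B" "card B = k"
      using k unfolding enat_le_cdim_iff by blast
    moreover have "cvec.span B \<subseteq> C" by (rule cvec.span_minimal[OF B(1) sC])
    ultimately show ?thesis using CM RC by (intro exI[of _ B]) auto
  qed
  show "enat k \<le> cdim C"
    if ex: "\<exists>B\<subseteq>M. finite B \<and> cvec.independent B \<and> card B = k \<and> cvec.span B \<inter> R \<subseteq> {0}"
  proof (cases "cdim C = \<infinity>")
    case False
    obtain D where D: "D \<subseteq> C" "finite D" "C \<subseteq> cvec.span D" "cdim C = enat (card D)"
      by (rule cdim_finite_basis[OF False])
    obtain B where B: "B \<subseteq> M" "finite B" "cvec.independent B" "card B = k" "cvec.span B \<inter> R \<subseteq> {0}"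
      using ex by blast
    have "\<exists>r\<in>R. b - r \<in> cvec.span D" if "b \<in> B" for b
    proof -
      have "b \<in> {r + c |r c. r \<in> R \<and> c \<in> C}" using that B(1) sum by blast
      then obtain r c where "b = r + c" "r \<in> R" "c \<in> C" by blast
      then show ?thesis using D(3) by (intro bexI[of _ r]) auto
    qed
    from independent_modulo_card_le[OF R B(2,3,5) D(2) this] show ?thesis using D(4) B(4) by simp
  qed simp
qed

lemma enat_eqI_le:
  assumes "\<And>k. enat k \<le> a \<longleftrightarrow> enat k \<le> b"
  shows "a = b"
proof (rule antisym)
  have *: "x \<le> y" if "\<And>k. enat k \<le> x \<Longrightarrow> enat k \<le> y" for x y
  proof (cases x)
    case infinity
    then have "enat k \<le> y" for k using that by simp
    then have "y = \<infinity>" using Suc_n_not_le_n by (cases y) (simp_all only: enat_ord_simps, blast+)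
    then show ?thesis by simp
  qed (use that in simp)
  show "a \<le> b" "b \<le> a" by (rule *, simp add: assms)+
qed

text \<open>All complements have the same dimension, because the number of independent vectors in a complement
  is determined by \<open>M\<close> and \<open>R\<close> alone.\<close>

lemma ccodim_eq_cdim_ccomplement:
  assumes R: "cvec.subspace R" and C: "ccomplement M R C"
  shows "ccodim M R = cdim C"
proof -
  have "cdim C' = cdim C" if "ccomplement M R C'" for C'
    by (rule enat_eqI_le)
      (simp only: enat_le_cdim_ccomplement_iff[OF R that] enat_le_cdim_ccomplement_iff[OF R C])
  then have "cdim ` {C. ccomplement M R C} = {cdim C}" using C by blast
  then show ?thesis by (simp add: ccodim_def)
qed

lemma enat_le_ccodim_iff:
  assumes "cvec.subspace M" and R: "cvec.subspace R" "R \<subseteq> M"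
  shows "enat k \<le> ccodim M R \<longleftrightarrow> (\<exists>B\<subseteq>M. finite B \<and> cvec.independent B \<and> card B = k
    \<and> cvec.span B \<inter> R \<subseteq> {0})"
proof -
  obtain C where "ccomplement M R C" using ccomplement_exists[OF assms] by blast
  then show ?thesis
    using ccodim_eq_cdim_ccomplement[OF R(1)] enat_le_cdim_ccomplement_iff[OF R(1)] by simp
qed

section \<open>Finite-dimensional subspaces of a normed space\<close>

lemma cmod_coefficient_le_infdist:
  assumes Y: "cvec.subspace Y" and x: "x - k *\<^sub>C b \<in> Y"
  shows "cmod k * infdist b Y \<le> norm x"
proof (cases "k = 0")
  case False
  have "- ((1/k) *\<^sub>C (x - k *\<^sub>C b)) \<in> Y"
    using cvec.subspace_scale[OF Y x] cvec.subspace_neg[OF Y] by blast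
  moreover have "- ((1/k) *\<^sub>C (x - k *\<^sub>C b)) = b - (1/k) *\<^sub>C x"
    using False by (simp add: cvec.scale_right_diff_distrib scaleC_scaleC scaleC_one)
  ultimately have "infdist b Y \<le> dist b (b - (1/k) *\<^sub>C x)" by (metis infdist_le)
  also have "\<dots> = norm x / cmod k" by (simp add: dist_norm norm_scaleC norm_divide)
  finally show ?thesis using False by (simp add: field_simps)
qed simp

text \<open>If \<open>b \<notin> Y\<close>, the coefficient of \<open>b\<close> depends continuously on the vector, so a convergent sequence
  in the span has convergent coefficients.\<close>

lemma closed_span_insert:
  fixes Y :: "'a::complex_banach set"
  assumes Y: "cvec.subspace Y" "closed Y"
  shows "closed (cvec.span (insert b Y))"
proof (cases "b \<in> Y")
  case True
  then show ?thesis using Y by (simp add: insert_absorb cvec.span_eq_iff[THEN iffD2])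
next
  case False
  have sp: "cvec.span (insert b Y) = {x. \<exists>k. x - k *\<^sub>C b \<in> Y}"
    using Y(1) by (simp add: cvec.span_insert cvec.span_eq_iff[THEN iffD2])
  define d where "d = infdist b Y"
  have "Y \<noteq> {}" using cvec.subspace_0[OF Y(1)] by blast
  then have d: "d > 0"
    using in_closed_iff_infdist_zero[OF Y(2), of b] False infdist_nonneg[of b Y]
    unfolding d_def by linarith
  show ?thesis unfolding sp closed_sequential_limits
  proof (intro allI impI, elim conjE)
    fix x l assume "\<forall>n. x n \<in> {x. \<exists>k. x - k *\<^sub>C b \<in> Y}" and lim: "x \<longlonglongrightarrow> l"
    then have "\<forall>n. \<exists>k. x n - k *\<^sub>C b \<in> Y" by blast
    from choice[OF this] obtain k where k: "\<And>n. x n - k n *\<^sub>C b \<in> Y" by blast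
    have kd: "cmod (k m - k n) * d \<le> norm (x m - x n)" for m n
    proof -
      have "(x m - k m *\<^sub>C b) - (x n - k n *\<^sub>C b) \<in> Y" using cvec.subspace_diff[OF Y(1) k k] .
      then have "(x m - x n) - (k m - k n) *\<^sub>C b \<in> Y"
        by (simp add: cvec.scale_left_diff_distrib algebra_simps)
      from cmod_coefficient_le_infdist[OF Y(1) this] show ?thesis by (simp add: d_def)
    qed
    have "Cauchy k"
    proof (rule metric_CauchyI)
      fix e :: real assume "e > 0"
      then obtain N where N: "\<And>m n. m \<ge> N \<Longrightarrow> n \<ge> N \<Longrightarrow> dist (x m) (x n) < e * d"
        using metric_CauchyD[OF LIMSEQ_imp_Cauchy[OF lim], of "e * d"] d by auto
      have "dist (k m) (k n) < e" if "m \<ge> N" "n \<ge> N" for m n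
        using kd[of m n] N[OF that] d by (simp add: dist_norm) (smt (verit) mult_right_less_imp_less)
      then show "\<exists>N. \<forall>m\<ge>N. \<forall>n\<ge>N. dist (k m) (k n) < e" by blast
    qed
    then obtain c where "k \<longlonglongrightarrow> c" using Cauchy_convergent convergent_def by blast
    then have "(\<lambda>n. x n - k n *\<^sub>C b) \<longlonglongrightarrow> l - c *\<^sub>C b"
      by (intro tendsto_diff lim tendsto_scaleC)
    then have "l - c *\<^sub>C b \<in> Y" by (rule closed_sequentially[OF Y(2) k])
    then show "l \<in> {x. \<exists>k. x - k *\<^sub>C b \<in> Y}" by blast
  qed
qed

lemma closed_span_Un_finite:
  fixes Y :: "'a::complex_banach set"
  assumes Y: "cvec.subspace Y" "closed Y" and "finite B"
  shows "closed (cvec.span (Y \<union> B))"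
  using \<open>finite B\<close>
proof (induction B)
  case empty
  then show ?case using Y by (simp add: cvec.span_eq_iff[THEN iffD2])
next
  case (insert b B)
  have "cvec.span (insert b (Y \<union> B)) = cvec.span (insert b (cvec.span (Y \<union> B)))"
    by (simp add: cvec.span_insert cvec.span_span)
  then show ?case using closed_span_insert[OF cvec.subspace_span insert.IH, of b] by simp
qed

lemma closed_span_finite:
  fixes B :: "'a::complex_banach set"
  assumes "finite B"
  shows "closed (cvec.span B)"
  using closed_span_Un_finite[of "{0}" B] assms
  by (simp add: cvec.subspace_single_0 cvec.span_insert_0)

text \<open>The projection of \<open>Y \<oplus> span B\<close> onto \<open>span B\<close> is bounded: apply the open mapping theorem to
  the injective addition map on \<open>Y \<times> span B\<close>.\<close>

lemma norm_le_norm_add_closed_subspace: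
  fixes Y :: "'a::complex_banach set"
  assumes Y: "cvec.subspace Y" "closed Y" and B: "finite B" "cvec.span B \<inter> Y \<subseteq> {0}"
  shows "\<exists>C>0. \<forall>w\<in>cvec.span B. \<forall>y\<in>Y. norm w \<le> C * norm (y + w)"
proof -
  let ?W = "cvec.span B" and ?f = "\<lambda>p::'a \<times> 'a. fst p + snd p"
  have f: "bounded_linear ?f" by (intro bounded_linear_add bounded_linear_fst bounded_linear_snd)
  have sub: "subspace (Y \<times> ?W)"
    by (intro subspace_Times csubspace_imp_subspace Y(1) cvec.subspace_span)
  have cl: "closed (Y \<times> ?W)" by (intro closed_Times Y(2) closed_span_finite B(1))
  have "?f ` (Y \<times> ?W) = cvec.span (Y \<union> B)"
    using Y(1) by (force simp: cvec.span_Un cvec.span_eq_iff[THEN iffD2])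
  then have "closed (?f ` (Y \<times> ?W))" using closed_span_Un_finite[OF Y B(1)] by simp
  from open_mapping_closed_image[OF f sub cl this] obtain C where C: "C > 0"
    and CC: "\<And>z. z \<in> ?f ` (Y \<times> ?W) \<Longrightarrow> \<exists>p\<in>Y \<times> ?W. ?f p = z \<and> norm p \<le> C * norm z"
    by blast
  have "norm w \<le> C * norm (y + w)" if w: "w \<in> ?W" and y: "y \<in> Y" for w y
  proof -
    have "y + w \<in> ?f ` (Y \<times> ?W)" using w y by force
    from CC[OF this] obtain y' w' where p: "y' \<in> Y" "w' \<in> ?W" "y' + w' = y + w"
      "norm (y', w') \<le> C * norm (y + w)" by auto
    have "w - w' = y' - y" using p(3) by (simp add: algebra_simps)
    moreover have "w - w' \<in> ?W" using w p(2) by (rule cvec.span_diff)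
    moreover have "y' - y \<in> Y" using p(1) y by (rule cvec.subspace_diff[OF Y(1)])
    ultimately have "w - w' = 0" using B(2) by auto
    then show ?thesis using p(4) norm_snd_le[of w' y'] by simp
  qed
  then show ?thesis using C by blast
qed

lemma sum_coefficients_le:
  fixes B :: "'a::complex_banach set"
  assumes B: "finite B" "cvec.independent B"
  shows "\<exists>C\<ge>0. \<forall>a. (\<Sum>b\<in>B. cmod (a b)) \<le> C * norm (\<Sum>b\<in>B. a b *\<^sub>C b)"
proof -
  define d where "d b = infdist b (cvec.span (B - {b}))" for b
  have d: "d b > 0" if "b \<in> B" for b
  proof -
    have "b \<notin> cvec.span (B - {b})" using B(2) that cvec.dependent_def by blast
    moreover have "closed (cvec.span (B - {b}))" using B(1) by (intro closed_span_finite) auto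
    moreover have "cvec.span (B - {b}) \<noteq> {}" using cvec.span_zero by blast
    ultimately show ?thesis
      using in_closed_iff_infdist_zero infdist_nonneg[of b "cvec.span (B - {b})"]
      unfolding d_def by (metis less_eq_real_def)
  qed
  have "(\<Sum>b\<in>B. cmod (a b)) \<le> (\<Sum>b\<in>B. 1 / d b) * norm (\<Sum>b\<in>B. a b *\<^sub>C b)" for a
    unfolding sum_distrib_right
  proof (rule sum_mono)
    fix b assume b: "b \<in> B"
    have "(\<Sum>b\<in>B. a b *\<^sub>C b) - a b *\<^sub>C b = (\<Sum>b\<in>B - {b}. a b *\<^sub>C b)"
      using b B(1) by (simp add: sum_diff1)
    also have "\<dots> \<in> cvec.span (B - {b})"
      by (intro cvec.span_sum cvec.span_scale cvec.span_base)
    finally have "cmod (a b) * d b \<le> norm (\<Sum>b\<in>B. a b *\<^sub>C b)"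
      unfolding d_def by (rule cmod_coefficient_le_infdist[OF cvec.subspace_span])
    then show "cmod (a b) \<le> 1 / d b * norm (\<Sum>b\<in>B. a b *\<^sub>C b)"
      using d[OF b] by (simp add: field_simps)
  qed
  moreover have "(\<Sum>b\<in>B. 1 / d b) \<ge> 0" using d by (intro sum_nonneg) (simp add: less_imp_le)
  ultimately show ?thesis by blast
qed

text \<open>Coefficients with respect to \<open>B\<close> are bounded by the norm, so moving every basis vector a
  little changes each linear combination by a small fraction of its norm; in particular no
  nontrivial combination can become \<open>0\<close>.\<close>

lemma perturbed_basis:
  fixes B :: "'a::complex_banach set"
  assumes B: "finite B" "cvec.independent B"
  shows "\<exists>\<delta>>0. \<forall>u. (\<forall>b\<in>B. norm (u b - b) \<le> \<delta>) \<longrightarrow>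
    inj_on u B \<and> cvec.independent (u ` B) \<and>
    (\<forall>a. norm ((\<Sum>b\<in>B. a b *\<^sub>C u b) - (\<Sum>b\<in>B. a b *\<^sub>C b)) \<le> 1/4 * norm (\<Sum>b\<in>B. a b *\<^sub>C b))"
proof -
  obtain C where C: "C \<ge> 0" and Cb: "\<And>a. (\<Sum>b\<in>B. cmod (a b)) \<le> C * norm (\<Sum>b\<in>B. a b *\<^sub>C b)"
    using sum_coefficients_le[OF B] by blast
  define \<delta> where "\<delta> = 1 / (4 * (C + 1))"
  have \<delta>: "\<delta> > 0" "\<delta> * C \<le> 1/4" using C by (auto simp: \<delta>_def field_simps)
  have near: "norm ((\<Sum>b\<in>B. a b *\<^sub>C u b) - (\<Sum>b\<in>B. a b *\<^sub>C b)) \<le> 1/4 * norm (\<Sum>b\<in>B. a b *\<^sub>C b)"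
    if u: "\<forall>b\<in>B. norm (u b - b) \<le> \<delta>" for u a
  proof -
    have "norm ((\<Sum>b\<in>B. a b *\<^sub>C u b) - (\<Sum>b\<in>B. a b *\<^sub>C b)) = norm (\<Sum>b\<in>B. a b *\<^sub>C (u b - b))"
      by (simp add: cvec.scale_right_diff_distrib sum_subtractf)
    also have "\<dots> \<le> (\<Sum>b\<in>B. cmod (a b) * \<delta>)"
      by (rule sum_norm_le) (use u in \<open>auto simp: norm_scaleC intro: mult_left_mono\<close>)
    also have "\<dots> = \<delta> * (\<Sum>b\<in>B. cmod (a b))" by (simp add: sum_distrib_left mult.commute)
    also have "\<dots> \<le> \<delta> * (C * norm (\<Sum>b\<in>B. a b *\<^sub>C b))"
      using Cb \<delta>(1) by (intro mult_left_mono) auto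
    also have "\<dots> \<le> 1/4 * norm (\<Sum>b\<in>B. a b *\<^sub>C b)"
      using mult_right_mono[OF \<delta>(2) norm_ge_zero[of "\<Sum>b\<in>B. a b *\<^sub>C b"]] by (simp add: mult_ac)
    finally show ?thesis .
  qed
  moreover have "inj_on u B \<and> cvec.independent (u ` B)"
    if u: "\<forall>b\<in>B. norm (u b - b) \<le> \<delta>" for u
  proof (rule independent_image_if_no_relation[OF B(1)])
    fix a assume "(\<Sum>b\<in>B. a b *\<^sub>C u b) = 0"
    with near[OF u, of a] have "(\<Sum>b\<in>B. a b *\<^sub>C b) = 0" by simp
    then show "\<forall>b\<in>B. a b = 0" using cvec.independentD[OF B(2,1) subset_refl] by blast
  qed
  ultimately show ?thesis using \<delta>(1) by blast
qed

section \<open>Operators with closed range on a closed invariant subspace\<close>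

definition shift :: "('a \<Rightarrow> 'a) \<Rightarrow> complex \<Rightarrow> 'a \<Rightarrow> 'a::complex_normed_vector" where
  "shift T z x = T x - z *\<^sub>C x"

lemma eventually_cmod_mult_le:
  assumes "c > 0" "e > 0"
  shows "\<forall>\<^sub>F z in nhds 0. cmod z * c \<le> e"
  unfolding eventually_nhds_metric
  using assms by (intro exI[of _ "e / c"]) (auto simp: field_simps)

locale closed_range_restriction =
  fixes T :: "'a::complex_banach \<Rightarrow> 'a" and M :: "'a set"
  assumes T: "T \<in> bounded_ops UNIV"
    and M: "cvec.subspace M" "closed M" and TM: "T ` M \<subseteq> M"
    and closed_range: "closed (T ` M)"
begin

lemma T_linear: "bounded_linear T" and T_scaleC: "T (c *\<^sub>C x) = c *\<^sub>C T x"
  using T by (auto simp: bounded_ops_UNIV)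

sublocale T: bounded_linear T by (rule T_linear)

lemma shift_linear: "bounded_linear (shift T z)"
  unfolding shift_def by (intro bounded_linear_sub T_linear bounded_linear_scaleC)

lemma shift_scaleC: "shift T z (c *\<^sub>C x) = c *\<^sub>C shift T z x"
  by (simp add: shift_def T_scaleC cvec.scale_right_diff_distrib scaleC_scaleC mult.commute)

lemma shift_0 [simp]: "shift T 0 = T"
  by (simp add: shift_def fun_eq_iff)

lemma shift_image: "shift T z ` M \<subseteq> M"
  using TM cvec.subspace_diff[OF M(1)] cvec.subspace_scale[OF M(1)] by (auto simp: shift_def)

lemma subspace_shift_image:
  assumes "cvec.subspace S"
  shows "cvec.subspace (shift T z ` S)"
proof -
  interpret A: bounded_linear "shift T z" by (rule shift_linear)
  show ?thesis
  proof (rule cvec.subspaceI)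
    show "0 \<in> shift T z ` S" using cvec.subspace_0[OF assms] A.zero by force
    show "x + y \<in> shift T z ` S" if "x \<in> shift T z ` S" "y \<in> shift T z ` S" for x y
      using that cvec.subspace_add[OF assms] by (auto simp flip: A.add)
    show "c *\<^sub>C x \<in> shift T z ` S" if "x \<in> shift T z ` S" for c x
      using that cvec.subspace_scale[OF assms] by (auto simp flip: shift_scaleC)
  qed
qed

lemma subspace_kernel: "cvec.subspace (kernel_on M (shift T z))"
proof -
  interpret A: bounded_linear "shift T z" by (rule shift_linear)
  show ?thesis
    using M(1) unfolding kernel_on_def cvec.subspace_def by (auto simp: A.zero A.add shift_scaleC)
qed

lemma closed_kernel: "closed (kernel_on M (shift T z))"
proof -
  have "kernel_on M (shift T z) = M \<inter> (shift T z -` {0})" by (auto simp: kernel_on_def)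
  moreover have "closed (shift T z -` {0})"
    by (intro closed_vimage closed_singleton linear_continuous_on shift_linear
        bounded_linear.continuous_on continuous_on_id)
  ultimately show ?thesis using M(2) by (simp add: closed_Int)
qed

lemma subspace_range: "cvec.subspace (T ` M)"
  using subspace_shift_image[OF M(1), of 0] by simp

lemma lift_bound: "\<exists>c>0. \<forall>y\<in>T ` M. \<exists>x\<in>M. T x = y \<and> norm x \<le> c * norm y"
  by (rule open_mapping_closed_image[OF T_linear csubspace_imp_subspace[OF M(1)] M(2) closed_range])

text \<open>The vector \<open>x\<close> and a short preimage of \<open>T x\<close> differ by an element of the kernel.\<close>

lemma kernel_distance_bound:
  "\<exists>c>0. \<forall>x\<in>M. \<exists>x0\<in>kernel_on M T. norm (x - x0) \<le> c * norm (T x)"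
proof -
  obtain c where c: "c > 0" and cc: "\<And>y. y \<in> T ` M \<Longrightarrow> \<exists>x\<in>M. T x = y \<and> norm x \<le> c * norm y"
    using lift_bound by blast
  have "\<exists>x0\<in>kernel_on M T. norm (x - x0) \<le> c * norm (T x)" if x: "x \<in> M" for x
  proof -
    obtain v where v: "v \<in> M" "T v = T x" "norm v \<le> c * norm (T x)" using cc[of "T x"] x by blast
    then show ?thesis using x cvec.subspace_diff[OF M(1) x v(1)]
      by (intro bexI[of _ "x - v"]) (auto simp: kernel_on_def T.diff)
  qed
  then show ?thesis using c by blast
qed

text \<open>With a finite-dimensional complement \<open>C\<close> of the range, \<open>(x, w) \<mapsto> T x + w\<close> maps \<open>M \<times> C\<close>
  onto \<open>M\<close>. A surjection stays surjective under a small perturbation, so \<open>C\<close> still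
  spans \<open>M\<close> modulo the range of \<open>T - z\<close>.\<close>

lemma eventually_defect_le:
  assumes "defect M T \<noteq> \<infinity>"
  shows "\<forall>\<^sub>F z in nhds 0. defect M (shift T z) \<le> defect M T"
proof -
  obtain C where C: "ccomplement M (T ` M) C"
    using ccomplement_exists[OF M(1) subspace_range TM] by blast
  have dC: "defect M T = cdim C"
    unfolding defect_def by (rule ccodim_eq_cdim_ccomplement[OF subspace_range C])
  have fin: "cdim C \<noteq> \<infinity>" using assms dC by simp
  obtain D where D: "D \<subseteq> C" "finite D" "C \<subseteq> cvec.span D" "cdim C = enat (card D)"
    by (rule cdim_finite_basis[OF fin])
  have sC: "cvec.subspace C" and sum: "{r + c |r c. r \<in> T ` M \<and> c \<in> C} = M"
    using C by (auto simp: ccomplement_def)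
  have spD: "cvec.span D = C" using D(1,3) cvec.span_minimal[OF D(1) sC] by blast
  have CM: "C \<subseteq> M" using sum cvec.subspace_0[OF subspace_range] by force
  let ?g = "\<lambda>z p::'a \<times> 'a. shift T z (fst p) + snd p"
  have g: "bounded_linear (?g z)" for z
    by (intro bounded_linear_add bounded_linear_compose[OF shift_linear] bounded_linear_fst
        bounded_linear_snd)
  have sub: "subspace (M \<times> C)" by (intro subspace_Times csubspace_imp_subspace M(1) sC)
  have "closed C" using closed_span_finite[OF D(2)] spD by simp
  then have cl: "closed (M \<times> C)" using M(2) by (intro closed_Times)
  have "?g 0 ` (M \<times> C) = {r + c |r c. r \<in> T ` M \<and> c \<in> C}" by force
  then have img: "?g 0 ` (M \<times> C) = M" using sum by simp
  have "closed (?g 0 ` (M \<times> C))" using img M(2) by simp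
  from open_mapping_closed_image[OF g sub cl this] obtain c where c: "c > 0"
    and cc: "\<And>y. y \<in> M \<Longrightarrow> \<exists>p\<in>M \<times> C. ?g 0 p = y \<and> norm p \<le> c * norm y"
    unfolding img by blast
  have "defect M (shift T z) \<le> defect M T" if z: "cmod z * c \<le> 1/2" for z
  proof -
    have surj: "\<exists>p\<in>M \<times> C. ?g z p = y" if y: "y \<in> M" for y
    proof -
      have "\<exists>p\<in>M \<times> C. ?g z p = y \<and> norm p \<le> c / (1 - 1/2) * norm y"
      proof (rule successive_approximation[OF g sub cl _ _ _ _ y])
        fix y assume "y \<in> M"
        from cc[OF this] obtain x w where p: "x \<in> M" "w \<in> C" "T x + w = y"
          and n: "norm (x, w) \<le> c * norm y" by auto
        have eq: "y - ?g z (x, w) = z *\<^sub>C x" using p(3) by (auto simp: shift_def)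
        have "norm x \<le> c * norm y" using n norm_fst_le[of x w] by linarith
        then have "norm (z *\<^sub>C x) \<le> cmod z * (c * norm y)"
          by (simp add: norm_scaleC mult_left_mono)
        also have "\<dots> \<le> 1/2 * norm y"
          using mult_right_mono[OF z norm_ge_zero[of y]] by (simp add: mult.assoc)
        finally have "norm (y - ?g z (x, w)) \<le> 1/2 * norm y" unfolding eq .
        moreover have "y - ?g z (x, w) \<in> M" unfolding eq by (rule cvec.subspace_scale[OF M(1) p(1)])
        ultimately show "\<exists>p\<in>M \<times> C. norm p \<le> c * norm y \<and> y - ?g z p \<in> M
            \<and> norm (y - ?g z p) \<le> 1/2 * norm y"
          using p n by (intro bexI[of _ "(x, w)"]) auto
      qed (use c in auto)
      then show ?thesis by blast
    qed
    show ?thesis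
    proof (rule ccontr)
      assume "\<not> ?thesis"
      then have "enat (Suc (card D)) \<le> defect M (shift T z)"
        using dC D(4) by (simp add: ileI1 flip: eSuc_enat)
      then obtain B where B: "B \<subseteq> M" "finite B" "cvec.independent B" "card B = Suc (card D)"
        "cvec.span B \<inter> shift T z ` M \<subseteq> {0}"
        unfolding defect_def enat_le_ccodim_iff[OF M(1) subspace_shift_image[OF M(1)] shift_image]
        by blast
      have "\<exists>r\<in>shift T z ` M. b - r \<in> cvec.span D" if b: "b \<in> B" for b
      proof -
        obtain p where "p \<in> M \<times> C" "?g z p = b" using surj b B(1) by blast
        then show ?thesis using spD by (intro bexI[of _ "shift T z (fst p)"]) auto
      qed
      from independent_modulo_card_le[OF subspace_shift_image[OF M(1)] B(2,3,5) D(2) this]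
      show False using B(4) by simp
    qed
  qed
  then show ?thesis using eventually_cmod_mult_le[OF c, of "1/2"] by (auto elim: eventually_mono)
qed

end

section \<open>Semi-regular operators are stable under small shifts\<close>

text \<open>In this form, inclusion of the kernel in the ranges of all powers, the condition
  \<open>dis(T\<^sub>M) = 0\<close> can be iterated along chains of preimages.\<close>

locale semi_regular_restriction = closed_range_restriction +
  assumes kernel_subset_image: "kernel_on M T \<subseteq> (T ^^ n) ` M"
begin

text \<open>The hyperrange of the restriction. For a semi-regular operator it contains the kernel and is
  stable under preimages, so an equation \<open>T u = y\<close> with \<open>y\<close> in the core can be
  solved again and again, with any choice of preimages.\<close>

definition core :: "'a set" where
  "core = (\<Inter>n. (T ^^ n) ` M)"

lemma kernel_subset_core: "kernel_on M T \<subseteq> core"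
  using kernel_subset_image by (auto simp: core_def)

lemma subspace_funpow_image: "cvec.subspace ((T ^^ n) ` M)"
proof (induction n)
  case (Suc n)
  have "(T ^^ Suc n) ` M = shift T 0 ` ((T ^^ n) ` M)" by (simp add: image_comp)
  then show ?case by (simp only:) (rule subspace_shift_image[OF Suc])
qed (use M in simp)

lemma subspace_core: "cvec.subspace core"
  unfolding core_def by (rule cvec.subspace_Inter) (use subspace_funpow_image in auto)

text \<open>If \<open>T x = T (T\<^sup>n v)\<close>, then \<open>x - T\<^sup>n v\<close> lies in the kernel, hence in the range
  of \<open>T\<^sup>n\<close>, and therefore so does \<open>x\<close>.\<close>

lemma preimage_in_core:
  assumes "x \<in> M" "T x \<in> core"
  shows "x \<in> core"
proof -
  have "x \<in> (T ^^ n) ` M" for n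
  proof -
    have "T x \<in> (T ^^ Suc n) ` M" using assms(2) unfolding core_def by blast
    then obtain v where v: "v \<in> M" "T x = T ((T ^^ n) v)" by auto
    have "(T ^^ n) v \<in> M" using TM v(1) by (induction n) auto
    then have "x - (T ^^ n) v \<in> kernel_on M T"
      using assms(1) v(2) cvec.subspace_diff[OF M(1)] by (simp add: kernel_on_def T.diff)
    then have "x - (T ^^ n) v \<in> (T ^^ n) ` M" using kernel_subset_image by blast
    then have "(x - (T ^^ n) v) + (T ^^ n) v \<in> (T ^^ n) ` M"
      using v(1) by (intro cvec.subspace_add[OF subspace_funpow_image]) auto
    then show ?thesis by simp
  qed
  then show ?thesis by (simp add: core_def)
qed

text \<open>A kernel vector \<open>x\<close> of \<open>T\<close> extends to the series
  \<open>x + z x\<^sub>1 + z\<^sup>2 x\<^sub>2 + \<dots>\<close> with \<open>T x\<^sub>1 = x\<close>, \<open>T x\<^sub>2 = x\<^sub>1\<close>, \<open>\<dots>\<close>, which lies in the kernel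
  of \<open>T - z\<close>. The preimages exist because \<open>x\<close> is in the core, and they can be chosen with
  geometrically bounded norms because the range is closed.\<close>

lemma eventually_kernel_close:
  assumes "\<delta> > 0"
  shows "\<forall>\<^sub>F z in nhds 0. \<forall>x\<in>kernel_on M T. \<exists>x'\<in>kernel_on M (shift T z).
    norm (x' - x) \<le> \<delta> * norm x"
proof -
  obtain c where c: "c > 0" and cc: "\<And>y. y \<in> T ` M \<Longrightarrow> \<exists>x\<in>M. T x = y \<and> norm x \<le> c * norm y"
    using lift_bound by blast
  have "\<exists>x'\<in>kernel_on M (shift T z). norm (x' - x) \<le> \<delta> * norm x"
    if z: "cmod z * c \<le> 1/2" "cmod z * c \<le> \<delta> / 2" and x: "x \<in> kernel_on M T" for z x
  proof -
    interpret A: bounded_linear "shift T z" by (rule shift_linear)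
    \<comment> \<open>Solving \<open>(T - z) u = z x\<close> with a small \<open>u\<close> gives \<open>(T - z) (x + u) = 0\<close>. An exact preimage
      under \<open>T\<close> of a vector \<open>y\<close> of the core leaves the error \<open>z u\<close>, which is small and again in
      the core.\<close>
    have "z *\<^sub>C x \<in> core"
      using x kernel_subset_core cvec.subspace_scale[OF subspace_core] by blast
    then have "\<exists>u\<in>M. shift T z u = z *\<^sub>C x \<and> norm u \<le> c / (1 - 1/2) * norm (z *\<^sub>C x)"
    proof (rule successive_approximation[OF shift_linear csubspace_imp_subspace[OF M(1)] M(2), rotated -1])
      fix y assume y: "y \<in> core"
      then have "y \<in> (T ^^ 1) ` M" unfolding core_def by blast
      then obtain u where u: "u \<in> M" "T u = y" "norm u \<le> c * norm y" using cc[of y] by auto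
      have eq: "y - shift T z u = z *\<^sub>C u" using u(2) by (simp add: shift_def)
      have "u \<in> core" using preimage_in_core u y by simp
      then have "y - shift T z u \<in> core" unfolding eq by (rule cvec.subspace_scale[OF subspace_core])
      moreover have "norm (y - shift T z u) \<le> 1/2 * norm y"
      proof -
        have "norm (z *\<^sub>C u) \<le> cmod z * (c * norm y)" using u(3) by (simp add: norm_scaleC mult_left_mono)
        also have "\<dots> \<le> 1/2 * norm y"
          using mult_right_mono[OF z(1) norm_ge_zero[of y]] by (simp add: mult.assoc)
        finally show ?thesis unfolding eq .
      qed
      ultimately show "\<exists>u\<in>M. norm u \<le> c * norm y \<and> y - shift T z u \<in> core
          \<and> norm (y - shift T z u) \<le> 1/2 * norm y"
        using u by blast
    qed (use c in auto)
    then obtain u where u: "u \<in> M" "shift T z u = z *\<^sub>C x" "norm u \<le> 2 * c * norm (z *\<^sub>C x)"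
      by auto
    have xM: "x \<in> M" "T x = 0" using x by (auto simp: kernel_on_def)
    have "shift T z (x + u) = 0" using u(2) xM by (simp add: A.add) (simp add: shift_def)
    then have "x + u \<in> kernel_on M (shift T z)"
      using cvec.subspace_add[OF M(1) xM(1) u(1)] by (simp add: kernel_on_def)
    moreover have "norm u \<le> \<delta> * norm x"
      using u(3) mult_right_mono[OF z(2) norm_ge_zero[of x]] by (simp add: norm_scaleC mult_ac)
    ultimately show ?thesis by (intro bexI[of _ "x + u"]) auto
  qed
  moreover have "\<forall>\<^sub>F z in nhds 0. cmod z * c \<le> 1/2 \<and> cmod z * c \<le> \<delta> / 2"
    using c assms by (intro eventually_conj eventually_cmod_mult_le) auto
  ultimately show ?thesis by (auto elim: eventually_mono)
qed

text \<open>Moving a finite independent set of the kernel of \<open>T\<close> slightly into the kernel of \<open>T - z\<close> keeps it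
  independent. If it spans the kernel of \<open>T\<close>, the moved vectors span the kernel of
  \<open>T - z\<close>: each \<open>x\<close> there satisfies \<open>T x = z x\<close>, so it is close to the kernel of \<open>T\<close> and hence to the
  span of the moved vectors, and this approximation can be iterated.\<close>

lemma eventually_kernel_basis:
  assumes B: "B \<subseteq> kernel_on M T" "finite B" "cvec.independent B"
  shows "\<forall>\<^sub>F z in nhds 0. \<exists>u. u ` B \<subseteq> kernel_on M (shift T z) \<and> inj_on u B
    \<and> cvec.independent (u ` B)
    \<and> (kernel_on M T \<subseteq> cvec.span B \<longrightarrow> kernel_on M (shift T z) \<subseteq> cvec.span (u ` B))"
proof -
  obtain c where c: "c > 0"
    and down: "\<And>x. x \<in> M \<Longrightarrow> \<exists>x0\<in>kernel_on M T. norm (x - x0) \<le> c * norm (T x)"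
    using kernel_distance_bound by blast
  obtain \<delta> where \<delta>: "\<delta> > 0"
    and pert: "\<And>u. \<forall>b\<in>B. norm (u b - b) \<le> \<delta> \<Longrightarrow> inj_on u B \<and> cvec.independent (u ` B) \<and>
      (\<forall>a. norm ((\<Sum>b\<in>B. a b *\<^sub>C u b) - (\<Sum>b\<in>B. a b *\<^sub>C b)) \<le> 1/4 * norm (\<Sum>b\<in>B. a b *\<^sub>C b))"
    using perturbed_basis[OF B(2,3)] by blast
  define m where "m = 1 + (\<Sum>b\<in>B. norm b)"
  have m: "m > 0" "\<And>b. b \<in> B \<Longrightarrow> norm b \<le> m"
    using member_le_sum[OF _ _ B(2), of _ norm] sum_nonneg[of B norm] by (force simp: m_def)+
  have "\<exists>u. u ` B \<subseteq> kernel_on M (shift T z) \<and> inj_on u B \<and> cvec.independent (u ` B)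
    \<and> (kernel_on M T \<subseteq> cvec.span B \<longrightarrow> kernel_on M (shift T z) \<subseteq> cvec.span (u ` B))"
    if z1: "cmod z * c \<le> 1/8" and up: "\<forall>x\<in>kernel_on M T. \<exists>x'\<in>kernel_on M (shift T z).
      norm (x' - x) \<le> \<delta> / m * norm x" for z
  proof -
    let ?K = "kernel_on M (shift T z)"
    have "\<forall>b\<in>B. \<exists>x'. x' \<in> ?K \<and> norm (x' - b) \<le> \<delta> / m * norm b" using up B(1) by blast
    from bchoice[OF this] obtain u
      where u: "\<forall>b\<in>B. u b \<in> ?K \<and> norm (u b - b) \<le> \<delta> / m * norm b" ..
    have "norm (u b - b) \<le> \<delta>" if b: "b \<in> B" for b
    proof -
      have "\<delta> / m * norm b \<le> \<delta> / m * m" using m \<delta> b by (intro mult_left_mono) auto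
      also have "\<dots> = \<delta>" using m(1) by simp
      finally show ?thesis using u b by fastforce
    qed
    from pert[OF ballI[OF this]] have inj: "inj_on u B" and ind: "cvec.independent (u ` B)"
      and near: "\<And>a. norm ((\<Sum>b\<in>B. a b *\<^sub>C u b) - (\<Sum>b\<in>B. a b *\<^sub>C b)) \<le> 1/4 * norm (\<Sum>b\<in>B. a b *\<^sub>C b)"
      by auto
    have uK: "u ` B \<subseteq> ?K" using u by blast
    have "?K \<subseteq> cvec.span (u ` B)" if spB: "kernel_on M T \<subseteq> cvec.span B"
    proof (rule closed_subspace_halving[OF csubspace_imp_subspace[OF cvec.subspace_span]])
      show "closed (cvec.span (u ` B))" using B(2) by (intro closed_span_finite) simp
      fix x assume x: "x \<in> ?K"
      then have xM: "x \<in> M" and Tx: "T x = z *\<^sub>C x" by (auto simp: kernel_on_def shift_def)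
      obtain x0 where x0: "x0 \<in> kernel_on M T" "norm (x - x0) \<le> c * norm (T x)"
        using down[OF xM] by blast
      have "c * norm (T x) = cmod z * c * norm x" by (simp add: Tx norm_scaleC)
      also have "\<dots> \<le> 1/8 * norm x" by (rule mult_right_mono[OF z1]) simp
      finally have d0: "norm (x - x0) \<le> 1/8 * norm x" using x0(2) by linarith
      obtain a where a: "x0 = (\<Sum>b\<in>B. a b *\<^sub>C b)"
        using x0(1) spB cvec.span_finite[OF B(2)] by auto
      define s where "s = (\<Sum>b\<in>B. a b *\<^sub>C u b)"
      have s: "s \<in> cvec.span (u ` B)"
        unfolding s_def by (intro cvec.span_sum cvec.span_scale cvec.span_base) auto
      have "cvec.span (u ` B) \<subseteq> ?K" by (rule cvec.span_minimal[OF uK subspace_kernel])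
      then have "x - s \<in> ?K" using s x cvec.subspace_diff[OF subspace_kernel] by blast
      moreover have "norm (x - s) \<le> 1/2 * norm x"
      proof -
        have "norm (s - x0) \<le> 1/4 * norm x0" using near[of a] by (simp add: a s_def)
        moreover have "norm x0 \<le> norm x + norm (x - x0)"
          using norm_triangle_sub[of x0 x] by (simp add: norm_minus_commute)
        moreover have "norm (x - s) \<le> norm (x - x0) + norm (s - x0)"
          using norm_triangle_ineq4[of "x - x0" "s - x0"] by simp
        ultimately show ?thesis using d0 norm_ge_zero[of x] by linarith
      qed
      ultimately show "\<exists>s\<in>cvec.span (u ` B). x - s \<in> ?K \<and> norm (x - s) \<le> 1/2 * norm x"
        using s by blast
    qed
    then show ?thesis using inj ind uK by blast
  qed
  moreover have "\<forall>\<^sub>F z in nhds 0. cmod z * c \<le> 1/8 \<and> (\<forall>x\<in>kernel_on M T.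
      \<exists>x'\<in>kernel_on M (shift T z). norm (x' - x) \<le> \<delta> / m * norm x)"
    using c \<delta> m(1) by (intro eventually_conj eventually_cmod_mult_le eventually_kernel_close) auto
  ultimately show ?thesis by (auto elim: eventually_mono)
qed

text \<open>How small \<open>z\<close> has to be may depend on \<open>k\<close>; this still determines the nullity of \<open>T\<close>, even an
  infinite one, once the nullity of \<open>T - z\<close> is known for arbitrarily small \<open>z\<close>.\<close>

lemma eventually_nullity_ge_iff:
  "\<forall>\<^sub>F z in nhds 0. enat k \<le> nullity M (shift T z) \<longleftrightarrow> enat k \<le> nullity M T"
proof (cases "enat k \<le> nullity M T")
  case True
  then obtain B where B: "B \<subseteq> kernel_on M T" "finite B" "cvec.independent B" "card B = k"
    unfolding nullity_def enat_le_cdim_iff by blast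
  show ?thesis
    using eventually_kernel_basis[OF B(1-3)]
  proof eventually_elim
    case (elim z)
    then obtain u where u: "u ` B \<subseteq> kernel_on M (shift T z)" "inj_on u B" "cvec.independent (u ` B)"
      by blast
    then have "enat k \<le> nullity M (shift T z)"
      unfolding nullity_def enat_le_cdim_iff using B(2,4) card_image[OF u(2)] by blast
    then show ?case using True by simp
  qed
next
  case False
  then have "cdim (kernel_on M T) \<noteq> \<infinity>" by (intro notI) (simp add: nullity_def)
  then obtain B where B: "B \<subseteq> kernel_on M T" "finite B" "cvec.independent B"
    "kernel_on M T \<subseteq> cvec.span B" "cdim (kernel_on M T) = enat (card B)"
    by (rule cdim_finite_basis)
  show ?thesis
    using eventually_kernel_basis[OF B(1-3)]
  proof eventually_elim
    case (elim z)
    then obtain u where u: "kernel_on M (shift T z) \<subseteq> cvec.span (u ` B)" using B(4) by blast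
    have "\<not> enat k \<le> nullity M (shift T z)"
    proof
      assume "enat k \<le> nullity M (shift T z)"
      then obtain E where E: "E \<subseteq> kernel_on M (shift T z)" "finite E" "cvec.independent E" "card E = k"
        unfolding nullity_def enat_le_cdim_iff by blast
      have "card E \<le> card (u ` B)"
        using cvec.independent_span_bound[of "u ` B" E] E u B(2) by auto
      also have "\<dots> \<le> card B" by (rule card_image_le[OF B(2)])
      finally show False using False B(5) E(4) by (simp add: nullity_def)
    qed
    then show ?case using False by simp
  qed
qed

text \<open>Vectors independent modulo the range of \<open>T\<close> stay independent modulo the range of \<open>T - z\<close>. Let
  \<open>(T - z) x = w\<close> with \<open>w\<close> in their span. The distance between the span and the closed range
  forces \<open>w\<close>, and then \<open>T x\<close>, to be of order \<open>z x\<close>. So \<open>x\<close> is close to the kernel of \<open>T\<close>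
  and hence to some \<open>s\<close> in the kernel of \<open>T - z\<close>. As \<open>x - s\<close> has the same image \<open>w\<close> and at most half
  the norm, the argument repeats; \<open>x\<close> lies in the closed kernel and \<open>w = 0\<close>.\<close>

lemma eventually_defect_ge:
  assumes "enat k \<le> defect M T"
  shows "\<forall>\<^sub>F z in nhds 0. enat k \<le> defect M (shift T z)"
proof -
  obtain B where B: "B \<subseteq> M" "finite B" "cvec.independent B" "card B = k" "cvec.span B \<inter> T ` M \<subseteq> {0}"
    using assms unfolding defect_def enat_le_ccodim_iff[OF M(1) subspace_range TM] by blast
  obtain c where c: "c > 0"
    and down: "\<And>x. x \<in> M \<Longrightarrow> \<exists>x0\<in>kernel_on M T. norm (x - x0) \<le> c * norm (T x)"
    using kernel_distance_bound by blast
  obtain C where C: "C > 0" and CC: "\<And>w y. w \<in> cvec.span B \<Longrightarrow> y \<in> T ` M \<Longrightarrow> norm w \<le> C * norm (y + w)"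
    using norm_le_norm_add_closed_subspace[OF subspace_range closed_range B(2,5)] by blast
  have "enat k \<le> defect M (shift T z)"
    if z: "cmod z * (c * (C + 1)) \<le> 1/8" and up: "\<forall>x\<in>kernel_on M T.
      \<exists>x'\<in>kernel_on M (shift T z). norm (x' - x) \<le> 1/4 * norm x" for z
  proof -
    interpret A: bounded_linear "shift T z" by (rule shift_linear)
    let ?K = "kernel_on M (shift T z)"
    \<comment> \<open>\<open>Y\<close> is stable under subtraction of kernel vectors, so halving applies to it.\<close>
    define Y where "Y = {x \<in> M. shift T z x \<in> cvec.span B}"
    have "Y \<subseteq> ?K"
    proof (rule closed_subspace_halving[OF csubspace_imp_subspace[OF subspace_kernel] closed_kernel])
      fix x assume "x \<in> Y"
      then have xM: "x \<in> M" and xB: "shift T z x \<in> cvec.span B" by (auto simp: Y_def)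
      have "norm (shift T z x) \<le> C * norm (- T x + shift T z x)"
        using subspace_range xM by (intro CC[OF xB]) (auto intro!: cvec.subspace_neg)
      also have "- T x + shift T z x = - (z *\<^sub>C x)" by (simp add: shift_def)
      finally have w: "norm (shift T z x) \<le> C * (cmod z * norm x)" by (simp add: norm_scaleC)
      have "norm (T x) \<le> norm (shift T z x) + norm (z *\<^sub>C x)"
        using norm_triangle_ineq[of "shift T z x" "z *\<^sub>C x"] by (simp add: shift_def)
      then have "norm (T x) \<le> (C + 1) * (cmod z * norm x)" using w by (simp add: norm_scaleC algebra_simps)
      then have "c * norm (T x) \<le> c * ((C + 1) * (cmod z * norm x))" using c by (intro mult_left_mono) auto
      also have "\<dots> = cmod z * (c * (C + 1)) * norm x" by (simp add: mult_ac)
      also have "\<dots> \<le> 1/8 * norm x" by (rule mult_right_mono[OF z]) simp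
      finally have small: "c * norm (T x) \<le> 1/8 * norm x" .
      obtain x0 where x0: "x0 \<in> kernel_on M T" "norm (x - x0) \<le> 1/8 * norm x"
        using down[OF xM] small by (meson order_trans)
      obtain s where s: "s \<in> ?K" "norm (s - x0) \<le> 1/4 * norm x0" using up x0(1) by blast
      have "norm x0 \<le> norm x + norm (x - x0)"
        using norm_triangle_sub[of x0 x] by (simp add: norm_minus_commute)
      moreover have "norm (x - s) \<le> norm (x - x0) + norm (s - x0)"
        using norm_triangle_ineq4[of "x - x0" "s - x0"] by simp
      ultimately have "norm (x - s) \<le> 1/2 * norm x"
        using s(2) x0(2) norm_ge_zero[of x] by linarith
      moreover have "x - s \<in> Y"
        using xM xB s(1) cvec.subspace_diff[OF M(1)] by (simp add: Y_def kernel_on_def A.diff)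
      ultimately show "\<exists>s\<in>?K. x - s \<in> Y \<and> norm (x - s) \<le> 1/2 * norm x" using s(1) by blast
    qed
    then have "cvec.span B \<inter> shift T z ` M \<subseteq> {0}" by (auto simp: Y_def kernel_on_def)
    then show ?thesis
      unfolding defect_def enat_le_ccodim_iff[OF M(1) subspace_shift_image[OF M(1)] shift_image]
      using B by blast
  qed
  moreover have "\<forall>\<^sub>F z in nhds 0. cmod z * (c * (C + 1)) \<le> 1/8 \<and> (\<forall>x\<in>kernel_on M T.
      \<exists>x'\<in>kernel_on M (shift T z). norm (x' - x) \<le> 1/4 * norm x)"
    using c C by (intro eventually_conj eventually_cmod_mult_le eventually_kernel_close) auto
  ultimately show ?thesis by (auto elim: eventually_mono)
qed

lemma eventually_defect_ge_iff:
  "\<forall>\<^sub>F z in nhds 0. enat k \<le> defect M (shift T z) \<longleftrightarrow> enat k \<le> defect M T"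
proof (cases "enat k \<le> defect M T")
  case True
  show ?thesis using eventually_defect_ge[OF True] by eventually_elim (use True in simp)
next
  case False
  then have "defect M T \<noteq> \<infinity>" by (intro notI) simp
  from eventually_defect_le[OF this] show ?thesis
    by eventually_elim (use False in \<open>auto dest: order_trans\<close>)
qed

end

section \<open>Ascent and descent of semi-regular operators\<close>

lemma cdim_eq_0_iff:
  assumes "cvec.subspace S"
  shows "cdim S = 0 \<longleftrightarrow> S = {0}"
proof -
  have "cdim S = 0 \<longleftrightarrow> \<not> enat 1 \<le> cdim S"
    by (cases "cdim S") (auto simp: zero_enat_def)
  also have "\<dots> \<longleftrightarrow> S = {0}"
  proof
    assume nd: "\<not> enat 1 \<le> cdim S"
    have "x = 0" if x: "x \<in> S" for x
    proof (rule ccontr)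
      assume "x \<noteq> 0"
      then have "\<exists>B\<subseteq>S. finite B \<and> cvec.independent B \<and> card B = 1"
        using x by (intro exI[of _ "{x}"]) (auto simp: cvec.dependent_single)
      then show False using nd unfolding enat_le_cdim_iff by blast
    qed
    then show "S = {0}" using cvec.subspace_0[OF assms] by blast
  next
    assume S: "S = {0}"
    show "\<not> enat 1 \<le> cdim S"
    proof
      assume "enat 1 \<le> cdim S"
      then obtain B where B: "B \<subseteq> S" "cvec.independent B" "card B = 1"
        unfolding enat_le_cdim_iff by blast
      have "B \<noteq> {}" using B(3) by auto
      then have "B = {0}" using B(1) unfolding S by (simp add: subset_singleton_iff)
      then show False using B(2) by (simp add: cvec.dependent_single)
    qed
  qed
  finally show ?thesis .
qed

lemma ccodim_eq_0_iff:
  assumes "cvec.subspace M" "cvec.subspace R" "R \<subseteq> M"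
  shows "ccodim M R = 0 \<longleftrightarrow> R = M"
proof -
  obtain C where C: "ccomplement M R C" using ccomplement_exists[OF assms] by blast
  then have sC: "cvec.subspace C" and RC: "R \<inter> C = {0}" and sum: "{r + c |r c. r \<in> R \<and> c \<in> C} = M"
    by (auto simp: ccomplement_def)
  have "C \<subseteq> M" using sum cvec.subspace_0[OF assms(2)] by force
  then have "C = {0}" if "R = M" using RC that by blast
  moreover have "R = M" if "C = {0}" using sum that by simp
  ultimately show ?thesis
    using ccodim_eq_cdim_ccomplement[OF assms(2) C] cdim_eq_0_iff[OF sC] by auto
qed

text \<open>For semi-regular operators the sequences of kernels and of ranges of powers stabilise at once or
  never.\<close>

lemma Inf_enat_eq_if:
  assumes "\<And>n. P n \<Longrightarrow> P 0"
  shows "Inf {enat n |n. P n} = (if P 0 then 0 else \<infinity>)"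
proof (cases "P 0")
  case True
  then have "enat 0 \<in> {enat n |n. P n}" by blast
  from Inf_lower[OF this] show ?thesis using True by (simp add: zero_enat_def[symmetric])
next
  case False
  then have "{enat n |n. P n} = {}" using assms by blast
  then show ?thesis using False by (simp add: Inf_enat_def)
qed

context semi_regular_restriction
begin

lemma funpow_in_M: "x \<in> M \<Longrightarrow> (T ^^ n) x \<in> M"
  using TM by (induction n) auto

lemma funpow_diff: "(T ^^ n) (x - y) = (T ^^ n) x - (T ^^ n) y"
  by (induction n) (auto simp: T.diff)

text \<open>The inclusion of the kernel of \<open>T\<close> in all ranges \<open>R(T\<^sup>m)\<close> passes to the kernels of powers.\<close>

lemma kernel_funpow_subset_range:
  assumes "x \<in> M" "(T ^^ n) x = 0"
  shows "x \<in> T ` M"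
  using assms
proof (induction n arbitrary: x)
  case 0
  then show ?case using cvec.subspace_0[OF subspace_range] by simp
next
  case (Suc n)
  have "(T ^^ n) x \<in> kernel_on M T"
    using Suc.prems funpow_in_M by (simp add: kernel_on_def)
  then have "(T ^^ n) x \<in> (T ^^ Suc n) ` M" using kernel_subset_image by blast
  then obtain y where y: "y \<in> M" "(T ^^ n) x = (T ^^ Suc n) y" by blast
  have Ty: "T y \<in> M" using TM y(1) by blast
  have "(T ^^ n) (x - T y) = 0" using y(2) by (simp add: funpow_diff funpow_swap1)
  then have "x - T y \<in> T ` M"
    using Suc.IH cvec.subspace_diff[OF M(1) Suc.prems(1) Ty] by blast
  from cvec.subspace_add[OF subspace_range this, of "T y"] show ?case using y(1) by simp
qed

text \<open>If \<open>N(T\<^sup>n) = N(T\<^sup>n\<^sup>+\<^sup>1)\<close> and \<open>T x = 0\<close>, then \<open>x = T\<^sup>n y\<close> for some \<open>y\<close>, so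
  \<open>y \<in> N(T\<^sup>n\<^sup>+\<^sup>1) = N(T\<^sup>n)\<close> and \<open>x = 0\<close>.\<close>

lemma ascent_eq: "ascent M T = (if nullity M T = 0 then 0 else \<infinity>)"
proof -
  have P0: "kernel_on M (T ^^ 0) = kernel_on M (T ^^ Suc 0) \<longleftrightarrow> nullity M T = 0"
    unfolding nullity_def using cdim_eq_0_iff[OF subspace_kernel[of 0]] cvec.subspace_0[OF M(1)]
    by (auto simp: kernel_on_def)
  have "kernel_on M (T ^^ 0) = kernel_on M (T ^^ Suc 0)"
    if eq: "kernel_on M (T ^^ n) = kernel_on M (T ^^ Suc n)" for n
  proof -
    have "x = 0" if x: "x \<in> kernel_on M T" for x
    proof -
      obtain y where y: "y \<in> M" "x = (T ^^ n) y" using x kernel_subset_image[of n] by blast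
      then have "y \<in> kernel_on M (T ^^ Suc n)" using x by (simp add: kernel_on_def)
      then have "y \<in> kernel_on M (T ^^ n)" using eq by simp
      then show "x = 0" using y by (simp add: kernel_on_def)
    qed
    then show ?thesis using cvec.subspace_0[OF M(1)] by (auto simp: kernel_on_def T.zero)
  qed
  from Inf_enat_eq_if[where P = "\<lambda>n. kernel_on M (T ^^ n) = kernel_on M (T ^^ Suc n)", OF this]
  show ?thesis unfolding ascent_def P0 .
qed

text \<open>If \<open>R(T\<^sup>n) = R(T\<^sup>n\<^sup>+\<^sup>1)\<close>, every \<open>x\<close> differs from some \<open>T y\<close> by an element of \<open>N(T\<^sup>n)\<close>, which
  lies in the range of \<open>T\<close>.\<close>

lemma descent_eq: "descent M T = (if defect M T = 0 then 0 else \<infinity>)"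
proof -
  have P0: "(T ^^ 0) ` M = (T ^^ Suc 0) ` M \<longleftrightarrow> defect M T = 0"
    unfolding defect_def ccodim_eq_0_iff[OF M(1) subspace_range TM] by (simp add: eq_commute)
  have "(T ^^ 0) ` M = (T ^^ Suc 0) ` M" if eq: "(T ^^ n) ` M = (T ^^ Suc n) ` M" for n
  proof -
    have "x \<in> T ` M" if x: "x \<in> M" for x
    proof -
      have "(T ^^ n) x \<in> (T ^^ Suc n) ` M" unfolding eq[symmetric] by (rule imageI[OF x])
      then obtain y where y: "y \<in> M" "(T ^^ n) x = (T ^^ Suc n) y" by blast
      have Ty: "T y \<in> M" using TM y(1) by blast
      have "(T ^^ n) (x - T y) = 0" using y(2) by (simp add: funpow_diff funpow_swap1)
      then have "x - T y \<in> T ` M"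
        using kernel_funpow_subset_range cvec.subspace_diff[OF M(1) x Ty] by blast
      from cvec.subspace_add[OF subspace_range this, of "T y"] show ?thesis using y(1) by simp
    qed
    then show ?thesis using TM by auto
  qed
  from Inf_enat_eq_if[where P = "\<lambda>n. (T ^^ n) ` M = (T ^^ Suc n) ` M", OF this]
  show ?thesis unfolding descent_def P0 .
qed

end

section \<open>Comparing two decompositions\<close>

lemma dis_eq_0D:
  assumes "dis M T = 0"
  shows "kernel_on M T \<subseteq> (T ^^ n) ` M"
proof -
  let ?A = "{enat m |m. \<forall>r\<ge>m. kernel_on ((T ^^ m) ` M) T = kernel_on ((T ^^ r) ` M) T}"
  have dis: "dis M T = Inf ?A" by (rule dis_def)
  have "?A \<noteq> {}"
  proof
    assume empty: "?A = {}"
    have "dis M T = \<infinity>" unfolding dis empty by (simp add: Inf_enat_def)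
    then show False using assms by simp
  qed
  then have "Inf ?A \<in> ?A" by (rule wellorder_InfI[OF some_in_eq[THEN iffD2]])
  then have "0 \<in> ?A" unfolding dis[symmetric] assms .
  then have "kernel_on M T = kernel_on ((T ^^ n) ` M) T" by (auto simp: zero_enat_def)
  then show ?thesis unfolding kernel_on_def by blast
qed

lemma gzKD_imp_semi_regular_restriction:
  fixes T :: "'a::complex_banach \<Rightarrow> 'a"
  assumes "T \<in> bounded_ops UNIV" "(M, N) \<in> gzKD T"
  shows "semi_regular_restriction T M"
proof
  show "kernel_on M T \<subseteq> (T ^^ n) ` M" for n
    using assms by (intro dis_eq_0D) (auto simp: gzKD_def semi_regular_def)
qed (use assms in \<open>auto simp: gzKD_def Red_def semi_regular_def\<close>)

text \<open>Since \<open>T - z\<close> is invertible on \<open>N\<close>, its kernel lies in \<open>M\<close>, and a complement of its range in \<open>M\<close>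
  is also a complement of its range in the whole space.\<close>

lemma shift_restriction_eq:
  fixes T :: "'a::complex_banach \<Rightarrow> 'a"
  assumes T: "T \<in> bounded_ops UNIV" and MN: "(M, N) \<in> gzKD T" and z: "z \<notin> spectrum_on N T"
  shows "nullity M (shift T z) = nullity UNIV (shift T z)"
    and "defect M (shift T z) = defect UNIV (shift T z)"
proof -
  interpret semi_regular_restriction T M by (rule gzKD_imp_semi_regular_restriction[OF T MN])
  interpret A: bounded_linear "shift T z" by (rule shift_linear)
  have N: "cvec.subspace N" "T ` N \<subseteq> N" and Int: "M \<inter> N = {0}"
    and sum: "{x + y |x y. x \<in> M \<and> y \<in> N} = UNIV"
    using MN by (auto simp: gzKD_def Red_def)
  obtain S where S: "S \<in> bounded_ops N" "\<And>x. x \<in> N \<Longrightarrow> S (shift T z x) = x"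
    "\<And>x. x \<in> N \<Longrightarrow> shift T z (S x) = x"
    using z by (auto simp: spectrum_on_def shift_def)
  have SN: "S x \<in> N" if "x \<in> N" for x using S(1) that by (auto simp: bounded_ops_def)
  have S0: "S 0 = 0" using S(2)[OF cvec.subspace_0[OF N(1)]] by (simp add: A.zero)
  have AN: "shift T z x \<in> N" if "x \<in> N" for x
    using N that cvec.subspace_diff[OF N(1)] cvec.subspace_scale[OF N(1)] by (auto simp: shift_def)
  have AM: "shift T z x \<in> M" if "x \<in> M" for x using shift_image that by blast
  have decomp: "\<exists>m\<in>M. \<exists>n\<in>N. x = m + n" for x
  proof -
    have "x \<in> {x + y |x y. x \<in> M \<and> y \<in> N}" using sum by blast
    then show ?thesis by blast
  qed
  have zero: "m = 0 \<and> n = 0" if "m \<in> M" "n \<in> N" "m + n = 0" for m n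
  proof -
    have "m = - n" using that(3) by (simp add: eq_neg_iff_add_eq_0)
    then have "m \<in> M \<inter> N" using that cvec.subspace_neg[OF N(1)] by blast
    then show ?thesis using Int that(3) by auto
  qed
  have "x \<in> M" if Ax: "shift T z x = 0" for x
  proof -
    obtain m n where x: "m \<in> M" "n \<in> N" "x = m + n" using decomp by blast
    have "shift T z m + shift T z n = 0" using Ax by (simp add: x(3) A.add)
    then have "shift T z n = 0" using zero AM AN x by blast
    then have "n = 0" using S(2)[OF x(2)] S0 by simp
    then show ?thesis using x by simp
  qed
  then show "nullity M (shift T z) = nullity UNIV (shift T z)"
    unfolding nullity_def kernel_on_def by (metis (no_types, lifting) UNIV_I)
  obtain C where C: "ccomplement M (shift T z ` M) C"
    using ccomplement_exists[OF M(1) subspace_shift_image[OF M(1)] shift_image] by blast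
  then have sC: "cvec.subspace C" and RC: "shift T z ` M \<inter> C = {0}"
    and sumC: "{r + c |r c. r \<in> shift T z ` M \<and> c \<in> C} = M"
    by (auto simp: ccomplement_def)
  have CM: "C \<subseteq> M" using sumC cvec.subspace_0[OF subspace_shift_image[OF M(1)]] by force
  have CU: "ccomplement UNIV (range (shift T z)) C"
    unfolding ccomplement_def
  proof (intro conjI)
    have "x = 0" if x: "x \<in> C" "x = shift T z v" for x v
    proof -
      obtain m n where v: "m \<in> M" "n \<in> N" "v = m + n" using decomp by blast
      have "(shift T z m - x) + shift T z n = 0" using x(2) by (simp add: v(3) A.add)
      then have "shift T z m - x = 0"
        using zero AM[OF v(1)] AN[OF v(2)] x(1) CM cvec.subspace_diff[OF M(1)] by blast
      then have "x \<in> shift T z ` M \<inter> C" using x(1) v(1) by auto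
      then show ?thesis using RC by blast
    qed
    moreover have "0 \<in> range (shift T z)" using A.zero by (metis rangeI)
    ultimately show "range (shift T z) \<inter> C = {0}" using cvec.subspace_0[OF sC] by blast
    have "\<exists>r\<in>range (shift T z). \<exists>c\<in>C. x = r + c" for x
    proof -
      obtain m n where x: "m \<in> M" "n \<in> N" "x = m + n" using decomp by blast
      have "m \<in> {r + c |r c. r \<in> shift T z ` M \<and> c \<in> C}" using x(1) sumC by blast
      then obtain v c where m: "c \<in> C" "m = shift T z v + c" by blast
      have "x = shift T z (v + S n) + c" using S(3)[OF x(2)] by (simp add: x(3) m(2) A.add)
      then show ?thesis using m(1) by blast
    qed
    then show "{r + c |r c. r \<in> range (shift T z) \<and> c \<in> C} = UNIV" by blast
  qed (rule sC)
  have "cvec.subspace (range (shift T z))" by (rule subspace_shift_image[OF cvec.subspace_UNIV])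
  then show "defect M (shift T z) = defect UNIV (shift T z)"
    unfolding defect_def using ccodim_eq_cdim_ccomplement[OF _ CU]
      ccodim_eq_cdim_ccomplement[OF subspace_shift_image[OF M(1)] C] by simp
qed

text \<open>Otherwise the two spectra cover a segment of positive reals near \<open>0\<close>. One of them contains
  infinitely many points of this compact set, hence has an accumulation point in it, although
  \<open>0\<close> is its only possible accumulation point.\<close>

lemma frequently_resolvent:
  assumes N: "zeroloid N T" and N': "zeroloid N' T"
  shows "\<exists>\<^sub>F z in nhds 0. z \<notin> spectrum_on N T \<and> z \<notin> spectrum_on N' T"
  unfolding frequently_def eventually_nhds_metric
proof clarify
  fix e :: real
  assume e: "e > 0" and cover: "\<forall>z. dist z 0 < e \<longrightarrow> \<not> (z \<notin> spectrum_on N T \<and> z \<notin> spectrum_on N' T)"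
  let ?I = "complex_of_real ` {e/3..e/2}"
  have "dist z 0 < e" if "z \<in> ?I" for z using that e by (auto simp: dist_norm)
  then have "?I \<subseteq> spectrum_on N T \<union> spectrum_on N' T" using cover by blast
  then have "?I = (?I \<inter> spectrum_on N T) \<union> (?I \<inter> spectrum_on N' T)" by blast
  moreover have "infinite ?I"
    using e by (subst finite_image_iff) (auto intro: inj_onI simp: infinite_Icc_iff)
  ultimately consider "infinite (?I \<inter> spectrum_on N T)" | "infinite (?I \<inter> spectrum_on N' T)"
    by (metis finite_UnI)
  then obtain K where K: "zeroloid K T" "infinite (?I \<inter> spectrum_on K T)" using N N' by cases auto
  have "compact ?I" by (intro compact_continuous_image continuous_intros) auto
  then obtain x where x: "x \<in> ?I" "x islimpt (?I \<inter> spectrum_on K T)"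
    using Heine_Borel_imp_Bolzano_Weierstrass[OF _ K(2)] by blast
  then have "x islimpt spectrum_on K T" using islimpt_subset by blast
  then have "x = 0" using K(1) by (auto simp: zeroloid_def)
  then show False using x(1) e by auto
qed

lemma gzKD_nullity_defect_eq:
  fixes T :: "'a::complex_banach \<Rightarrow> 'a"
  assumes T: "T \<in> bounded_ops UNIV" and MN: "(M, N) \<in> gzKD T" and MN': "(M', N') \<in> gzKD T"
  shows "nullity M T = nullity M' T" and "defect M T = defect M' T"
proof -
  interpret M: semi_regular_restriction T M by (rule gzKD_imp_semi_regular_restriction[OF T MN])
  interpret M': semi_regular_restriction T M' by (rule gzKD_imp_semi_regular_restriction[OF T MN'])
  have freq: "\<exists>\<^sub>F z in nhds 0. z \<notin> spectrum_on N T \<and> z \<notin> spectrum_on N' T"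
    by (rule frequently_resolvent) (use MN MN' in \<open>auto simp: gzKD_def\<close>)
  show "nullity M T = nullity M' T"
  proof (rule enat_eqI_le)
    fix k
    obtain z where "z \<notin> spectrum_on N T" "z \<notin> spectrum_on N' T"
      "enat k \<le> nullity M (shift T z) \<longleftrightarrow> enat k \<le> nullity M T"
      "enat k \<le> nullity M' (shift T z) \<longleftrightarrow> enat k \<le> nullity M' T"
      using frequently_ex[OF frequently_eventually_conj[OF freq eventually_conj[OF
            M.eventually_nullity_ge_iff[of k] M'.eventually_nullity_ge_iff[of k]]]] by blast
    then show "enat k \<le> nullity M T \<longleftrightarrow> enat k \<le> nullity M' T"
      using shift_restriction_eq(1)[OF T MN] shift_restriction_eq(1)[OF T MN'] by simp
  qed
  show "defect M T = defect M' T"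
  proof (rule enat_eqI_le)
    fix k
    obtain z where "z \<notin> spectrum_on N T" "z \<notin> spectrum_on N' T"
      "enat k \<le> defect M (shift T z) \<longleftrightarrow> enat k \<le> defect M T"
      "enat k \<le> defect M' (shift T z) \<longleftrightarrow> enat k \<le> defect M' T"
      using frequently_ex[OF frequently_eventually_conj[OF freq eventually_conj[OF
            M.eventually_defect_ge_iff[of k] M'.eventually_defect_ge_iff[of k]]]] by blast
    then show "enat k \<le> defect M T \<longleftrightarrow> enat k \<le> defect M' T"
      using shift_restriction_eq(2)[OF T MN] shift_restriction_eq(2)[OF T MN'] by simp
  qed
qed

theorem proposition2p10:
  fixes T :: "'a::complex_banach \<Rightarrow> 'a"
    and M N M' N' :: "'a set"
  assumes "cdim (UNIV :: 'a set) = \<infinity>"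
    and "T \<in> bounded_ops UNIV"
    and "gz_Kato T"
    and "(M, N) \<in> gzKD T"
    and "(M', N') \<in> gzKD T"
  shows "nullity M T = nullity M' T \<and> defect M T = defect M' T
    \<and> ascent M T = ascent M' T \<and> descent M T = descent M' T"
proof -
  interpret M: semi_regular_restriction T M
    by (rule gzKD_imp_semi_regular_restriction[OF assms(2,4)])
  interpret M': semi_regular_restriction T M'
    by (rule gzKD_imp_semi_regular_restriction[OF assms(2,5)])
  show ?thesis
    using gzKD_nullity_defect_eq[OF assms(2,4,5)]
    by (simp add: M.ascent_eq M'.ascent_eq M.descent_eq M'.descent_eq)
qed

end
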